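(* $$\int_0^1 x\,\log\Gamma(x)\,\cot(\pi x)\,dx=\frac{1}{2\pi}\left[\gamma_1+\frac12\left(\zeta(2)+\gamma^2\right)\right].$$
   Context: $\Gamma$ is the gamma function, $\zeta$ the Riemann zeta function and $\gamma$ Euler's constant. The Stieltjes constants $\gamma_n(x)$ are defined by the Laurent expansion of the Hurwitz zeta function $\zeta(s,x)$ about $s=1$: $\zeta(s,x)=\frac{1}{s-1}+\sum_{n=0}^\infty\frac{(-1)^n}{n!}\gamma_n(x)(s-1)^n$, and $\gamma_n:=\gamma_n(1)$; thus $\gamma_1=\gamma_1(1)$ is the first Stieltjes constant. *)

theory Defs
  imports "HOL-Complex_Analysis.Complex_Analysis"
begin

(* The series for zeta(s,x) converges for Re s > 1; f continues it to the larger half-plane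
   Re s > c (c <= 1), punctured at s = 1. *)
definition hurwitz_continuation :: "real \<Rightarrow> real \<Rightarrow> (complex \<Rightarrow> complex) \<Rightarrow> bool" where
  "hurwitz_continuation c x f \<longleftrightarrow>
     c \<le> 1 \<and> f holomorphic_on ({s. Re s > c} - {1}) \<and>
     (\<forall>s. Re s > 1 \<longrightarrow> f s = (\<Sum>n. (of_nat n + of_real x) powr (-s)))"

(* Meant for x > 0 and s \<noteq> 1. The punctured half-planes are nested and connected, so the value at s
   does not depend on c and f (hurwitz_zeta_eqI below). At the pole s = 1 the value is unspecified. *)
definition hurwitz_zeta :: "complex \<Rightarrow> real \<Rightarrow> complex" where
  "hurwitz_zeta s x = (THE z. \<exists>c f. hurwitz_continuation c x f \<and> c < Re s \<and> f s = z)"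

definition zeta :: "complex \<Rightarrow> complex" where
  "zeta s = hurwitz_zeta s 1"

(* The coefficient of (s - 1)^n in the Laurent expansion at s = 1 is (-1)^n / n! * gamma_n(x). *)
definition stieltjes :: "nat \<Rightarrow> real \<Rightarrow> complex" where
  "stieltjes n x =
     (-1) ^ n * fact n * fls_nth (laurent_expansion (\<lambda>s. hurwitz_zeta s x) 1) (int n)"

lemma hurwitz_continuation_unique:
  assumes f: "hurwitz_continuation c x f" and g: "hurwitz_continuation d x g"
    and s: "c < Re s" "d < Re s" "s \<noteq> 1"
  shows "f s = g s"
proof -
  define H where "H = {s. Re s > max c d}"
  have H: "open H" "connected H"
    unfolding H_def using convex_halfspace_Re_gt open_halfspace_Re_gt
    by (blast intro: convex_connected)+
  have sub: "H - {1} \<subseteq> {s. Re s > c} - {1}" "H - {1} \<subseteq> {s. Re s > d} - {1}"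
    by (auto simp: H_def)
  have le: "max c d \<le> 1"
    using f g by (auto simp: hurwitz_continuation_def)
  have "connected (H - {1})"
    using H by (intro connected_open_delete) auto
  moreover have "f holomorphic_on (H - {1})" "g holomorphic_on (H - {1})"
    using f g sub unfolding hurwitz_continuation_def by (blast intro: holomorphic_on_subset)+
  moreover have "{s. Re s > 1} \<subseteq> H - {1}"
    using le by (auto simp: H_def)
  moreover have "f w = g w" if "w \<in> {s. Re s > 1}" for w
    using f g that by (simp add: hurwitz_continuation_def)
  moreover have "s \<in> H - {1}"
    using s by (simp add: H_def)
  ultimately show ?thesis
    using H by (intro analytic_continuation_open[of "{s. Re s > 1}" "H - {1}" f g s])
      (auto simp: open_halfspace_Re_gt intro!: open_delete exI[of _ "2::complex"])
qed

lemma hurwitz_zeta_eqI: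
  assumes "hurwitz_continuation c x f" "c < Re s" "s \<noteq> 1"
  shows "hurwitz_zeta s x = f s"
  unfolding hurwitz_zeta_def
  using assms by (intro the_equality) (auto dest: hurwitz_continuation_unique)

end

(* Abel summation of the sine series of the cotangent, cot (pi x) = lim (2 sum r^k sin (2 pi k x))
   as r tends to 1, reduces the integral to the sine coefficients
   b_k of x ln Gamma(x). Integrating by parts, 2 pi k b_k is the sum of the k-th cosine coefficients
   of ln Gamma(x), which is 1/(4k) by the reflection formula, and of x psi(x). Expanding psi in
   partial fractions, the latter is the sum over j >= 1 of the integral of
   sin^2(pi k u) / (pi^2 k^2 u^3) over u >= j. The substitution u -> k u / j exchanges j and k, and
   sum_j sin^2(pi j u) / j^2 = (pi^2/2) {u} (1 - {u}) then leaves an elementary integral over u >= k,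
   with value (ln k + gamma - H_k + 1/(2k)) / 2.
   Hence 4 pi k b_k = ln k + gamma - H_k + 1/k, and the sum of the b_k is evaluated with
   sum_{k <= n} H_k / k = (H_n^2 + sum_{k <= n} 1/k^2) / 2, gamma_1 entering as the limit of
   sum_{k <= n} (ln k) / k - (ln n)^2 / 2. *)

theory Submission
  imports Defs
begin

text \<open>The sine series of the cotangent diverges in general, hence the factors r^k. For r < 1
  the summed kernel at 2 pi x is at most 1 / sin (pi x) in absolute value, uniformly in r; as ln
  Gamma vanishes at 1 and is only logarithmic at 0, x ln Gamma(x) times the kernel is dominated by a
  multiple of x^(-1/2). On the side of the coefficients the limit needs absolute convergence, which
  follows from convergence and b_k >= 0. Positivity also settles the double series: two integrations
  by parts turn cos (2 pi k u) / u into a nonnegative kernel of order u^(-3), so the exchange of j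
  and k is an instance of Tonelli's theorem in the extended nonnegative reals. The reflection
  formula is enough for ln Gamma because the cosine is symmetric under x -> 1 - x. The constant
  gamma_1 enters as minus the coefficient of (s - 1)^2 in (s - 1) zeta(s); a compensated series for
  that function converges uniformly near 1, so the coefficient is taken term by term.\<close>

section \<open>Zeta function and Stieltjes constants\<close>

text \<open>The \<open>n\<close>-th term of the series for \<open>(s - 1) \<zeta>(s) - 1\<close>, where \<open>(n + 1)\<^sup>-\<^sup>s\<close> is compensated by
  the integral of \<open>t\<^sup>-\<^sup>s\<close> over \<open>[n + 1, n + 2]\<close>; this gives convergence for \<open>Re s > 0\<close>, although
  \<open>Re s > 1/2\<close> is enough here.\<close>
definition zeta_term :: "nat \<Rightarrow> complex \<Rightarrow> complex" where
  "zeta_term n s = (s - 1) * (of_nat n + 1) powr (-s) + (of_nat n + 2) powr (1 - s) - (of_nat n + 1) powr (1 - s)"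

definition zeta_pole_free :: "complex \<Rightarrow> complex" where
  "zeta_pole_free s = 1 + (\<Sum>n. zeta_term n s)"

lemma norm_powr_minus_le:
  fixes m t :: real and s :: complex
  assumes "1 \<le> m" "m \<le> t" "Re s \<le> -b" "b \<ge> 0"
  shows "norm (of_real t powr s) \<le> m powr (-b)"
proof -
  have "norm (of_real t powr s) = t powr (Re s)"
    using assms by (simp add: norm_powr_real_powr)
  also have "\<dots> \<le> t powr (-b)"
    using assms by (intro powr_mono) auto
  also have "\<dots> \<le> m powr (-b)"
    using assms by (intro powr_mono2') auto
  finally show ?thesis .
qed

text \<open>The mean value inequality, twice on [m, m + 1] with m = n + 1:
  \<open>zeta_term n s\<close> is the increment of \<open>v\<close>, whose derivative is (1 - s)
  (z^(-s) - m^(-s)); this difference is bounded through the derivative -s z^(-s-1), of size at most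
  |s| m^(-3/2) as Re s >= 1/2.\<close>

lemma norm_zeta_term_le:
  assumes s: "Re s \<ge> 1/2"
  shows "norm (zeta_term n s) \<le> norm (s - 1) * norm s * (real n + 1) powr (-3/2)"
proof -
  define m where "m = real n + 1"
  define S where "S = closed_segment (complex_of_real m) (of_real (m + 1))"
  have m: "m \<ge> 1" by (simp add: m_def)
  have S: "\<exists>t. m \<le> t \<and> t \<le> m + 1 \<and> z = of_real t" if "z \<in> S" for z
    using that unfolding S_def closed_segment_of_real by (auto simp: closed_segment_eq_real_ivl)
  have nonpos: "of_real t \<notin> \<real>\<^sub>\<le>\<^sub>0" if "t \<ge> m" for t :: real
    using that m by (simp add: complex_nonpos_Reals_iff)
  have conv: "convex S" unfolding S_def by simp
  have mem: "complex_of_real m \<in> S" "complex_of_real (m + 1) \<in> S"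
    unfolding S_def by simp_all
  let ?B = "norm s * m powr (-3/2)"
  have 1: "norm (z powr (-s) - of_real m powr (-s)) \<le> ?B" if z: "z \<in> S" for z
  proof -
    have "norm (z powr (-s) - of_real m powr (-s)) \<le> ?B * norm (z - of_real m)"
    proof (rule field_differentiable_bound[OF conv _ _ z mem(1)])
      fix w assume "w \<in> S"
      then obtain t where t: "m \<le> t" "t \<le> m + 1" "w = of_real t" using S by blast
      show "((\<lambda>z. z powr (-s)) has_field_derivative (-s) * w powr (-s - 1)) (at w within S)"
        using nonpos[OF t(1)] t(3) by (auto intro!: derivative_eq_intros)
      have "norm (w powr (-s - 1)) \<le> m powr (-(3/2))"
        unfolding t(3) by (rule norm_powr_minus_le) (use t m s in auto)
      thus "norm ((-s) * w powr (-s - 1)) \<le> ?B"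
        by (simp add: norm_mult mult_left_mono)
    qed
    also have "norm (z - of_real m) \<le> 1"
    proof -
      obtain t where t: "m \<le> t" "t \<le> m + 1" "z = of_real t" using S z by blast
      have "z - of_real m = of_real (t - m)" using t by simp
      also have "norm \<dots> \<le> 1" unfolding norm_of_real using t by auto
      finally show ?thesis .
    qed
    hence "?B * norm (z - of_real m) \<le> ?B" by (intro mult_left_le) auto
    finally show ?thesis .
  qed
  define v where "v = (\<lambda>z. (s - 1) * of_real m powr (-s) * z + z powr (1 - s))"
  have "norm (v (of_real (m + 1)) - v (of_real m)) \<le> (norm (s - 1) * ?B) * norm (complex_of_real (m + 1) - of_real m)"
  proof (rule field_differentiable_bound[OF conv _ _ mem(2) mem(1)])
    fix w assume w: "w \<in> S"
    then obtain t where t: "m \<le> t" "t \<le> m + 1" "w = of_real t" using S by blast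
    show "(v has_field_derivative ((s - 1) * of_real m powr (-s) + (1 - s) * w powr (-s))) (at w within S)"
      unfolding v_def using nonpos[OF t(1)] t(3) by (auto intro!: derivative_eq_intros)
    have "(s - 1) * of_real m powr (-s) + (1 - s) * w powr (-s) = (1 - s) * (w powr (-s) - of_real m powr (-s))"
      by (simp add: algebra_simps)
    thus "norm ((s - 1) * of_real m powr (-s) + (1 - s) * w powr (-s)) \<le> norm (s - 1) * ?B"
      using 1[OF w] by (simp add: norm_mult norm_minus_commute mult_left_mono)
  qed
  also have "v (of_real (m + 1)) - v (of_real m) = zeta_term n s"
    by (simp add: v_def zeta_term_def m_def algebra_simps)
  finally show ?thesis by (simp add: m_def mult_ac)
qed

lemma summable_shift_powr: "summable (\<lambda>n. (real n + 1) powr (-3/2))"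
proof -
  have "summable (\<lambda>n. real (Suc n) powr (-3/2))"
    by (subst summable_Suc_iff) (simp add: summable_real_powr_iff)
  thus ?thesis by (simp add: add_ac)
qed

lemma uniform_limit_zeta_term:
  assumes A: "bounded A" "\<And>s. s \<in> A \<Longrightarrow> Re s \<ge> 1/2"
  shows "uniform_limit A (\<lambda>N s. 1 + (\<Sum>n<N. zeta_term n s)) zeta_pole_free sequentially"
proof -
  obtain R where R: "\<And>s. s \<in> A \<Longrightarrow> norm s \<le> R" "R > 0"
    using A(1) bounded_pos by metis
  have "uniform_limit A (\<lambda>N s. \<Sum>n<N. zeta_term n s) (\<lambda>s. \<Sum>n. zeta_term n s) sequentially"
  proof (rule Weierstrass_m_test)
    fix n s assume s: "s \<in> A"
    have "norm (s - 1) \<le> R + 1"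
      using R(1)[OF s] norm_triangle_ineq4[of s 1] by simp
    hence "norm (s - 1) * norm s * (real n + 1) powr (-3/2) \<le> (R + 1) * R * (real n + 1) powr (-3/2)"
      using R(1)[OF s] R(2) by (intro mult_mono) auto
    thus "norm (zeta_term n s) \<le> (R + 1) * R * (real n + 1) powr (-3/2)"
      using norm_zeta_term_le[OF A(2)[OF s]] by (rule order_trans[rotated])
  qed (intro summable_mult summable_shift_powr)
  thus ?thesis unfolding zeta_pole_free_def by (intro uniform_limit_intros)
qed

lemma zeta_term_holomorphic [holomorphic_intros]: "zeta_term n holomorphic_on A"
proof -
  have "(of_nat n + 2 :: complex) \<noteq> 0"
    by (metis of_nat_add of_nat_numeral of_nat_eq_0_iff add_is_0 zero_neq_numeral)
  moreover have "(of_nat n + 1 :: complex) \<noteq> 0"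
    by (metis of_nat_Suc of_nat_eq_0_iff nat.distinct(1) add.commute)
  ultimately show ?thesis
    unfolding zeta_term_def by (auto intro!: holomorphic_intros)
qed

lemma zeta_pole_free_holomorphic: "zeta_pole_free holomorphic_on {s. Re s > 1/2}"
proof (rule holomorphic_uniform_sequence)
  show "open {s. Re s > 1/2}" by (rule open_halfspace_Re_gt)
  show "(\<lambda>s. 1 + (\<Sum>n<N. zeta_term n s)) holomorphic_on {s. Re s > 1/2}" for N
    by (intro holomorphic_intros)
  fix x assume "x \<in> {s. Re s > 1/2}"
  then obtain d where d: "d > 0" "cball x d \<subseteq> {s. Re s > 1/2}"
    using open_halfspace_Re_gt open_contains_cball by metis
  hence "uniform_limit (cball x d) (\<lambda>N s. 1 + (\<Sum>n<N. zeta_term n s)) zeta_pole_free sequentially"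
    by (intro uniform_limit_zeta_term) auto
  with d show "\<exists>d>0. cball x d \<subseteq> {s. Re s > 1/2} \<and>
      uniform_limit (cball x d) (\<lambda>N s. 1 + (\<Sum>n<N. zeta_term n s)) zeta_pole_free sequentially"
    by blast
qed

text \<open>The compensating powers telescope: 1 plus the first N terms is (s - 1) times a partial
  sum of the zeta series plus (N + 1)^(1 - s), which tends to 0 because Re s > 1.\<close>

lemma zeta_series_sums:
  assumes s: "Re s > 1"
  shows "(\<lambda>n. (of_nat n + 1) powr (-s)) sums (zeta_pole_free s / (s - 1))"
proof -
  have "uniform_limit {s} (\<lambda>N s. 1 + (\<Sum>n<N. zeta_term n s)) zeta_pole_free sequentially"
    using s by (intro uniform_limit_zeta_term) auto
  hence "(\<lambda>N. 1 + (\<Sum>n<N. zeta_term n s)) \<longlonglongrightarrow> zeta_pole_free s"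
    by (rule tendsto_uniform_limitI) simp
  moreover have "(\<lambda>N. (of_nat N + 1) powr (1 - s)) \<longlonglongrightarrow> 0"
  proof (rule tendsto_norm_zero_cancel)
    have "(\<lambda>N. (real N + 1) powr (1 - Re s)) \<longlonglongrightarrow> 0"
      using s by real_asymp
    moreover have "norm ((complex_of_nat N + 1) powr (1 - s)) = (real N + 1) powr (1 - Re s)" for N
      using norm_powr_real_powr[of "of_nat N + 1" "1 - s"] by simp
    ultimately show "(\<lambda>N. norm ((complex_of_nat N + 1) powr (1 - s))) \<longlonglongrightarrow> 0" by simp
  qed
  ultimately have "(\<lambda>N. (1 + (\<Sum>n<N. zeta_term n s) - (of_nat N + 1) powr (1 - s)) / (s - 1))
     \<longlonglongrightarrow> (zeta_pole_free s - 0) / (s - 1)"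
    using s by (intro tendsto_intros) auto
  also have "(\<lambda>N. (1 + (\<Sum>n<N. zeta_term n s) - (of_nat N + 1) powr (1 - s)) / (s - 1)) =
     (\<lambda>N. \<Sum>n<N. (of_nat n + 1) powr (-s))"
  proof
    fix N
    have "1 + (\<Sum>n<N. zeta_term n s) - (of_nat N + 1) powr (1 - s) = (s - 1) * (\<Sum>n<N. (of_nat n + 1) powr (-s))"
      by (induction N) (simp_all add: zeta_term_def algebra_simps)
    thus "(1 + (\<Sum>n<N. zeta_term n s) - (of_nat N + 1) powr (1 - s)) / (s - 1) =
       (\<Sum>n<N. (of_nat n + 1) powr (-s))"
      using s by (metis nonzero_mult_div_cancel_left one_complex.sel(1) order_less_irrefl right_minus_eq)
  qed
  finally show ?thesis by (simp add: sums_def)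
qed

lemma hurwitz_continuation_one: "hurwitz_continuation (1/2) 1 (\<lambda>s. zeta_pole_free s / (s - 1))"
  unfolding hurwitz_continuation_def
proof (intro conjI allI impI)
  show "(\<lambda>s. zeta_pole_free s / (s - 1)) holomorphic_on {s. 1 / 2 < Re s} - {1}"
    using zeta_pole_free_holomorphic
    by (auto intro!: holomorphic_intros elim!: holomorphic_on_subset)
  show "zeta_pole_free s / (s - 1) = (\<Sum>n. (of_nat n + of_real 1) powr (-s))" if "1 < Re s" for s
    using zeta_series_sums[OF that] by (simp add: sums_iff)
qed simp

lemma zeta_2: "zeta 2 = of_real (pi\<^sup>2 / 6)"
proof -
  have "zeta 2 = zeta_pole_free 2 / (2 - 1)"
    unfolding zeta_def by (rule hurwitz_zeta_eqI[OF hurwitz_continuation_one]) auto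
  moreover have "(\<lambda>n. (of_nat n + 1 :: complex) powr (-2)) sums (zeta_pole_free 2 / (2 - 1))"
    by (rule zeta_series_sums) simp
  moreover have "(of_nat n + 1 :: complex) powr (-2) = of_real (1 / (real n + 1)\<^sup>2)" for n :: nat
  proof -
    have "(of_nat n + 1 :: complex) \<noteq> 0"
      by (metis of_nat_Suc of_nat_eq_0_iff nat.distinct(1) add.commute)
    thus ?thesis by (simp add: powr_minus powr_nat field_simps)
  qed
  ultimately have "(\<lambda>n. complex_of_real (1 / (real n + 1)\<^sup>2)) sums zeta 2"
    by simp
  moreover have "(\<lambda>n. complex_of_real (1 / (real n + 1)\<^sup>2)) sums of_real (pi\<^sup>2 / 6)"
    using inverse_squares_sums by (subst sums_of_real_iff) (simp add: add_ac)
  ultimately show ?thesis by (rule sums_unique2)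
qed

lemma has_fps_expansion_zeta_term:
  "(\<lambda>w. zeta_term n (1 + w)) has_fps_expansion
     fps_const (1 / (of_nat n + 1)) * (fps_X * fps_exp (- of_real (ln (real n + 1))))
      + fps_exp (- of_real (ln (real n + 2))) - fps_exp (- of_real (ln (real n + 1)))"
proof -
  have eq: "zeta_term n (1 + w) = 1 / (of_nat n + 1) * (w * exp (- of_real (ln (real n + 1)) * w))
      + exp (- of_real (ln (real n + 2)) * w) - exp (- of_real (ln (real n + 1)) * w)" for w
  proof -
    have *: "(of_real x :: complex) powr z = exp (z * of_real (ln x))" if "x > 0" for x :: real and z
      using that by (simp add: powr_def Ln_of_real)
    have ab: "real n + 1 > 0" "real n + 2 > 0" by simp_all
    have "zeta_term n (1 + w) = w * of_real (real n + 1) powr (-1 - w) + of_real (real n + 2) powr (-w) - of_real (real n + 1) powr (-w)"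
      by (simp add: zeta_term_def)
    also have "\<dots> = w * (exp (- of_real (ln (real n + 1))) * exp (- of_real (ln (real n + 1)) * w))
      + exp (- of_real (ln (real n + 2)) * w) - exp (- of_real (ln (real n + 1)) * w)"
      by (simp only: *[OF ab(1)] *[OF ab(2)] flip: exp_add) (simp add: algebra_simps)
    also have "exp (- complex_of_real (ln (real n + 1))) = 1 / (of_nat n + 1)"
      by (simp add: exp_minus exp_of_real inverse_eq_divide flip: of_real_minus)
    finally show ?thesis by (simp add: mult_ac)
  qed
  show ?thesis unfolding eq by (intro fps_expansion_intros)
qed

text \<open>Derivatives of a locally uniform limit of holomorphic functions converge, so the
  coefficient of w^2 in (s - 1) zeta(s), with s = 1 + w, is the sum of those of the terms. The
  squared logarithms telescope: the partial sums are sum_{k <= N} (ln k) / k - (ln (N + 1))^2 /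
  2.\<close>

lemma stieltjes_one_sums:
  "(\<lambda>n. complex_of_real (ln (real n + 1) / (real n + 1) - ((ln (real n + 2))\<^sup>2 - (ln (real n + 1))\<^sup>2) / 2))
     sums stieltjes 1 1"
proof -
  define g where "g = (\<lambda>w. zeta_pole_free (1 + w))"
  define gN where "gN = (\<lambda>N w. 1 + (\<Sum>n<N. zeta_term n (1 + w)))"
  define G where "G = fps_expansion g 0"
  have hol: "g holomorphic_on ball 0 (1/2)"
  proof -
    have "1/2 < Re (1 + w)" if "w \<in> ball 0 (1/2)" for w
      using that abs_Re_le_cmod[of w] by auto
    hence "(\<lambda>w. 1 + w) ` ball 0 (1/2) \<subseteq> {s. Re s > 1/2}" by blast
    with zeta_pole_free_holomorphic have "zeta_pole_free holomorphic_on (\<lambda>w. 1 + w) ` ball 0 (1/2)"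
      by (rule holomorphic_on_subset)
    moreover have "(\<lambda>w::complex. 1 + w) holomorphic_on ball 0 (1/2)" by (intro holomorphic_intros)
    ultimately show ?thesis
      unfolding g_def using holomorphic_on_compose[of "\<lambda>w. 1 + w" "ball 0 (1/2)" zeta_pole_free] by (simp only: o_def)
  qed
  have gG: "g has_fps_expansion G"
    unfolding G_def by (rule has_fps_expansion_fps_expansion[OF _ _ hol]) auto
  have "uniform_limit (ball 1 (1/2)) (\<lambda>N s. 1 + (\<Sum>n<N. zeta_term n s)) zeta_pole_free sequentially"
  proof (rule uniform_limit_zeta_term)
    fix s :: complex assume "s \<in> ball 1 (1/2)"
    hence "cmod (1 - s) < 1/2" by (simp add: dist_norm)
    thus "1/2 \<le> Re s" using abs_Re_le_cmod[of "1 - s"] by auto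
  qed auto
  hence ul: "uniform_limit (ball 0 (1/2)) gN g sequentially"
    unfolding gN_def g_def by (rule uniform_limit_compose') (auto simp: dist_norm norm_minus_commute)
  define c where "c = (\<lambda>n::nat. - of_real (ln (real n + 1)) / (of_nat n + 1) +
      ((of_real (ln (real n + 2)))\<^sup>2 - (of_real (ln (real n + 1)))\<^sup>2) / 2 :: complex)"
  have co: "(deriv ^^ 2) (gN N) 0 / fact 2 = (\<Sum>n<N. c n)" for N
  proof -
    let ?F = "1 + (\<Sum>n<N. fps_const (1 / (of_nat n + 1)) * (fps_X * fps_exp (- of_real (ln (real n + 1))))
      + fps_exp (- of_real (ln (real n + 2))) - fps_exp (- of_real (ln (real n + 1)))) :: complex fps"
    have "gN N has_fps_expansion ?F"
      unfolding gN_def by (intro fps_expansion_intros has_fps_expansion_zeta_term)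
    hence "(deriv ^^ 2) (gN N) 0 / fact 2 = fps_nth ?F 2"
      by (rule fps_nth_fps_expansion[symmetric])
    also have "\<dots> = (\<Sum>n<N. c n)"
      by (simp add: fps_sum_nth c_def eval_nat_numeral diff_divide_distrib) (simp add: algebra_simps)
    finally show ?thesis .
  qed
  have "(\<lambda>N. (deriv ^^ 2) (gN N) 0) \<longlonglongrightarrow> (deriv ^^ 2) g 0"
    by (rule higher_deriv_complex_uniform_limit[OF ul])
       (auto simp: gN_def intro!: always_eventually holomorphic_intros holomorphic_on_compose[of _ _ "zeta_term _", unfolded o_def])
  hence "(\<lambda>N. (deriv ^^ 2) (gN N) 0 / fact 2) \<longlonglongrightarrow> (deriv ^^ 2) g 0 / fact 2"
    by (intro tendsto_intros) auto
  also have "(deriv ^^ 2) g 0 / fact 2 = fps_nth G 2"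
    by (rule fps_nth_fps_expansion[OF gG, symmetric])
  finally have sums: "c sums fps_nth G 2"
    unfolding co sums_def .

  \<comment> \<open>Dividing by w shifts indices by one: gamma_1, at index 1 of the Laurent series
    with factor (-1)^1 1!, is minus the coefficient of \<open>G\<close> at index 2.\<close>
  have "laurent_expansion (\<lambda>s. hurwitz_zeta s 1) 1 = fls_shift 1 (fps_to_fls G)"
  proof (rule laurent_expansion_eqI)
    have "(\<lambda>w. g w * w powi (-1)) has_laurent_expansion fls_shift 1 (fps_to_fls G)"
      by (intro has_laurent_expansion_shift' has_laurent_expansion_fps gG)
    also have "?this \<longleftrightarrow> (\<lambda>w. hurwitz_zeta (1 + w) 1) has_laurent_expansion fls_shift 1 (fps_to_fls G)"
    proof (rule has_laurent_expansion_cong)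
      have "\<forall>\<^sub>F w in at 0. w \<in> ball 0 (1/2) - {0 :: complex}"
        by (intro eventually_at_in_open) auto
      thus "\<forall>\<^sub>F w in at 0. g w * w powi (-1) = hurwitz_zeta (1 + w) 1"
      proof eventually_elim
        case (elim w)
        have "1/2 < Re (1 + w)" "1 + w \<noteq> 1"
          using elim abs_Re_le_cmod[of w] by auto
        from hurwitz_zeta_eqI[OF hurwitz_continuation_one this] show ?case
          by (simp add: g_def power_int_minus divide_inverse)
      qed
    qed simp
    finally show "(\<lambda>w. hurwitz_zeta (1 + w) 1) has_laurent_expansion fls_shift 1 (fps_to_fls G)" .
  qed
  hence "stieltjes 1 1 = - fps_nth G 2"
    by (simp add: stieltjes_def)
  with sums_minus[OF sums] show ?thesis
    by (simp add: c_def algebra_simps)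
qed

section \<open>A harmonic series\<close>

text \<open>The left side is the sum of 1 / (i j) over 1 <= i <= j <= N: half of the full square
  plus half of the diagonal.\<close>

lemma sum_harm_over_Suc:
  "(\<Sum>n<N. harm (Suc n) / (real n + 1)) = ((harm N)\<^sup>2 + (\<Sum>n<N. 1 / (real n + 1)\<^sup>2)) / 2"
proof (induction N)
  case 0
  show ?case by (simp add: harm_def)
next
  case (Suc N)
  define h where "h = (harm N :: real)"
  define t where "t = 1 / (real N + 1)"
  have h: "harm (Suc N) = h + t"
    by (simp add: harm_Suc h_def t_def inverse_eq_divide add_ac)
  have t2: "1 / (real N + 1)\<^sup>2 = t\<^sup>2" by (simp add: t_def power_divide)
  have "(\<Sum>n<Suc N. harm (Suc n) / (real n + 1)) = (h\<^sup>2 + (\<Sum>n<N. 1 / (real n + 1)\<^sup>2)) / 2 + (h + t) * t"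
    using Suc.IH h by (simp add: h_def t_def del: of_nat_Suc)
  also have "\<dots> = ((harm (Suc N))\<^sup>2 + (\<Sum>n<Suc N. 1 / (real n + 1)\<^sup>2)) / 2"
    unfolding h sum.lessThan_Suc t2 by (simp add: power2_eq_square field_simps)
  finally show ?case .
qed

text \<open>The error is O(1/N), which beats the logarithm. The second limit disposes of the cross
  term that appears when \<open>harm N\<close>, written as ln (N + 1) + gamma + d N, is
  squared.\<close>

lemma harm_minus_ln_tendsto_0:
  defines "d \<equiv> \<lambda>N. harm N - ln (real N + 1) - euler_mascheroni"
  shows "d \<longlonglongrightarrow> 0" "(\<lambda>N. ln (real N + 1) * d N) \<longlonglongrightarrow> 0"
proof -
  have le: "norm (d N) \<le> 1 / (2 * real N)" if "N \<ge> 1" for N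
  proof -
    obtain n where n: "N = Suc n" using \<open>N \<ge> 1\<close> by (metis Suc_le_D One_nat_def)
    have "d N = harm (Suc n) - ln (real (n + 2)) - euler_mascheroni"
      unfolding d_def n by (simp add: add_ac)
    moreover have "1 / (2 * real N) = 1 / real (2 * (n + 1))" by (simp add: n)
    moreover have "1 / real (2 * (n + 2)) \<ge> 0" by simp
    ultimately show ?thesis
      using euler_mascheroni_lower[of n] euler_mascheroni_upper[of n] unfolding real_norm_def by linarith
  qed
  have "\<forall>\<^sub>F N in sequentially. norm (d N) \<le> 1 / (2 * real N)"
    by (rule eventually_mono[OF eventually_ge_at_top le])
  moreover have "(\<lambda>N. 1 / (2 * real N)) \<longlonglongrightarrow> 0" by real_asymp
  ultimately show "d \<longlonglongrightarrow> 0"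
    by (rule Lim_null_comparison)
  have le':  "norm (ln (real N + 1) * d N) \<le> ln (real N + 1) * (1 / (2 * real N))" if "N \<ge> 1" for N
  proof -
    have "norm (ln (real N + 1)) = ln (real N + 1)" by simp
    thus ?thesis
      unfolding norm_mult using mult_left_mono[OF le[OF that], of "ln (real N + 1)"] by simp
  qed
  have "\<forall>\<^sub>F N in sequentially. norm (ln (real N + 1) * d N) \<le> ln (real N + 1) * (1 / (2 * real N))"
    by (rule eventually_mono[OF eventually_ge_at_top le'])
  moreover have "(\<lambda>N. ln (real N + 1) * (1 / (2 * real N))) \<longlonglongrightarrow> 0" by real_asymp
  ultimately show "(\<lambda>N. ln (real N + 1) * d N) \<longlonglongrightarrow> 0"
    by (rule Lim_null_comparison)
qed

text \<open>For k = n + 1 the numerator is ln k - Digamma k, since Digamma k = H_(k-1) - gamma.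
  Substituting H_N = ln (N + 1) + gamma + d_N into the partial sums cancels the terms in ln^2 and
  gamma ln; gamma^2 / 2 and half the sum of the 1/k^2 remain beside the series for S.\<close>

lemma ln_minus_Digamma_series_sums:
  assumes "(\<lambda>n. ln (real n + 1) / (real n + 1) - ((ln (real n + 2))\<^sup>2 - (ln (real n + 1))\<^sup>2) / 2) sums S"
  shows "(\<lambda>n. (ln (real n + 1) + euler_mascheroni - harm (Suc n) + 1 / (real n + 1)) / (real n + 1))
           sums (S + (pi\<^sup>2 / 6 + euler_mascheroni\<^sup>2) / 2)"
proof -
  define s where "s = (\<lambda>n. ln (real n + 1) / (real n + 1) - ((ln (real n + 2))\<^sup>2 - (ln (real n + 1))\<^sup>2) / 2)"
  define d where "d = (\<lambda>N. harm N - ln (real N + 1) - euler_mascheroni :: real)"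
  define e where "e = (euler_mascheroni :: real)"
  have part: "(\<Sum>n<N. (ln (real n + 1) + e - harm (Suc n) + 1 / (real n + 1)) / (real n + 1)) =
     (\<Sum>n<N. s n) + (\<Sum>n<N. 1 / (real n + 1)\<^sup>2) / 2 + e\<^sup>2 / 2 - ln (real N + 1) * d N - (d N)\<^sup>2 / 2" for N
  proof -
    have ln_sum: "(\<Sum>n<N. ln (real n + 1) / (real n + 1)) = (\<Sum>n<N. s n) + (ln (real N + 1))\<^sup>2 / 2"
      unfolding s_def by (induction N) (simp_all add: add_ac diff_divide_distrib)
    have harm_sum: "(\<Sum>n<N. 1 / (real n + 1)) = harm N"
      by (simp add: harm_altdef inverse_eq_divide add_ac)
    have "(\<Sum>n<N. (ln (real n + 1) + e - harm (Suc n) + 1 / (real n + 1)) / (real n + 1)) =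
      (\<Sum>n<N. ln (real n + 1) / (real n + 1)) + e * (\<Sum>n<N. 1 / (real n + 1))
       - (\<Sum>n<N. harm (Suc n) / (real n + 1)) + (\<Sum>n<N. 1 / (real n + 1)\<^sup>2)"
      by (simp add: add_divide_distrib diff_divide_distrib sum.distrib sum_subtractf sum_distrib_left power2_eq_square
          del: of_nat_Suc)
    also have "\<dots> = (\<Sum>n<N. s n) + (ln (real N + 1))\<^sup>2 / 2 + e * harm N
        - ((harm N)\<^sup>2 + (\<Sum>n<N. 1 / (real n + 1)\<^sup>2)) / 2 + (\<Sum>n<N. 1 / (real n + 1)\<^sup>2)"
      unfolding ln_sum harm_sum sum_harm_over_Suc ..
    also have "harm N = ln (real N + 1) + e + d N"
      by (simp add: d_def e_def)
    finally have *: "(\<Sum>n<N. (ln (real n + 1) + e - harm (Suc n) + 1 / (real n + 1)) / (real n + 1)) =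
        (\<Sum>n<N. s n) + (ln (real N + 1))\<^sup>2 / 2 + e * (ln (real N + 1) + e + d N)
        - ((ln (real N + 1) + e + d N)\<^sup>2 + (\<Sum>n<N. 1 / (real n + 1)\<^sup>2)) / 2 + (\<Sum>n<N. 1 / (real n + 1)\<^sup>2)" .
    have alg: "U + l\<^sup>2 / 2 + e * (l + e + x) - ((l + e + x)\<^sup>2 + T) / 2 + T = U + T / 2 + e\<^sup>2 / 2 - l * x - x\<^sup>2 / 2"
      for U T l x :: real
      by (simp add: power2_eq_square field_simps)
    show ?thesis
      by (rule trans[OF * alg])
  qed
  have "(\<lambda>N. (\<Sum>n<N. s n) + (\<Sum>n<N. 1 / (real n + 1)\<^sup>2) / 2 + e\<^sup>2 / 2 - ln (real N + 1) * d N - (d N)\<^sup>2 / 2)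
    \<longlonglongrightarrow> S + (pi\<^sup>2 / 6) / 2 + e\<^sup>2 / 2 - 0 - 0\<^sup>2 / 2"
    using assms inverse_squares_sums harm_minus_ln_tendsto_0
    by (intro tendsto_intros) (simp_all add: s_def d_def sums_def add_ac)
  thus ?thesis
    unfolding sums_def e_def[symmetric] part by (simp add: add_divide_distrib add_ac)
qed

section \<open>The series of squared sines\<close>

text \<open>Absolute summability makes the power series converge uniformly on [0, 1], so continuity
  at 1 comes from the M-test instead of Abel's theorem.\<close>

lemma abel_sum_tendsto:
  fixes a r :: "nat \<Rightarrow> real"
  assumes a: "summable (\<lambda>n. \<bar>a n\<bar>)" and r: "\<And>m. 0 \<le> r m" "\<And>m. r m \<le> 1" "r \<longlonglongrightarrow> 1"
  shows "(\<lambda>m. \<Sum>n. r m ^ n * a n) \<longlonglongrightarrow> (\<Sum>n. a n)"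
proof -
  have "uniform_limit {0..1} (\<lambda>N x. \<Sum>n<N. x ^ n * a n) (\<lambda>x. \<Sum>n. x ^ n * a n) sequentially"
    by (rule Weierstrass_m_test[OF _ a]) (auto simp: abs_mult power_le_one mult_left_le_one_le)
  hence "continuous_on {0..1} (\<lambda>x. \<Sum>n. x ^ n * a n)"
    by (rule uniform_limit_theorem[rotated]) (auto intro!: always_eventually continuous_intros)
  from continuous_on_tendsto_compose[OF this r(3)] r show ?thesis by simp
qed

lemma has_integral_suminf_uniform:
  fixes f :: "nat \<Rightarrow> real \<Rightarrow> real"
  assumes cont: "\<And>n. continuous_on {a..b} (f n)"
    and int: "\<And>n. (f n has_integral I n) {a..b}"
    and le: "\<And>n x. x \<in> {a..b} \<Longrightarrow> \<bar>f n x\<bar> \<le> M n"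
    and M: "summable M"
  shows "((\<lambda>x. \<Sum>n. f n x) has_integral (\<Sum>n. I n)) {a..b}"
proof -
  have "uniform_limit {a..b} (\<lambda>N x. \<Sum>n<N. f n x) (\<lambda>x. \<Sum>n. f n x) sequentially"
    using le by (intro Weierstrass_m_test[OF _ M]) auto
  then obtain I' J where J: "\<And>N. ((\<lambda>x. \<Sum>n<N. f n x) has_integral I' N) {a..b}"
    "((\<lambda>x. \<Sum>n. f n x) has_integral J) {a..b}" "I' \<longlonglongrightarrow> J"
    by (rule uniform_limit_integral) (auto intro!: continuous_intros cont)
  have "I' = (\<lambda>N. \<Sum>n<N. I n)"
    using J(1) by (intro ext has_integral_unique[OF J(1) has_integral_sum]) (auto intro: int)
  with J(3) have "I sums J" by (simp add: sums_def)
  with J(2) show ?thesis by (simp add: sums_iff)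
qed

text \<open>The imaginary part of -Ln (1 - z) = sum z^n / n at z = r exp (2 pi i t); the term n = 0
  is 0 by the convention for division by zero.\<close>

lemma sin_power_series_sums:
  assumes r: "0 \<le> r" "r < 1"
  shows "(\<lambda>n. r ^ n * (sin (2 * pi * real n * t) / real n)) sums - Im (Ln (1 - of_real r * cis (2 * pi * t)))"
proof -
  define z where "z = of_real r * cis (2 * pi * t)"
  have "(\<lambda>n. - ((- (- z)) ^ n) / of_nat n) sums Ln (1 + - z)"
    by (rule Ln_series') (use r in \<open>simp add: z_def norm_mult\<close>)
  from sums_minus[OF sums_Im[OF this]]
  have "(\<lambda>n. Im (z ^ n) / real n) sums - Im (Ln (1 - z))"
    by simp
  moreover have "Im (z ^ n) = r ^ n * sin (2 * pi * real n * t)" for n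
  proof -
    have "z ^ n = of_real (r ^ n) * cis (real n * (2 * pi * t))"
      by (simp only: z_def power_mult_distrib Complex.DeMoivre of_real_power)
    thus ?thesis by (simp add: mult_ac)
  qed
  ultimately show ?thesis by (simp add: z_def)
qed

text \<open>Polar form: 1 - exp (2 pi i t) = 2 sin (pi t) exp (i (pi t - pi / 2)), with its angle in
  the principal range. The positive real part keeps the point off the branch cut, so
  \<open>Ln\<close> is continuous there when r tends to 1.\<close>

lemma Im_Ln_one_minus_cis:
  assumes t: "0 < t" "t < 1"
  shows "Im (Ln (1 - cis (2 * pi * t))) = pi * (t - 1/2)"
    and "Re (1 - cis (2 * pi * t)) > 0"
proof -
  have s: "sin (pi * t) > 0"
    using t by (intro sin_gt_zero) auto
  define w where "w = Complex (ln (2 * sin (pi * t))) (pi * t - pi / 2)"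
  have "exp w = 1 - cis (2 * pi * t)"
  proof (rule complex_eqI)
    have "Re (exp w) = 2 * sin (pi * t) * sin (pi * t)"
      using s by (simp add: w_def Re_exp cos_diff)
    also have "\<dots> = Re (1 - cis (2 * pi * t))"
      using cos_double_sin[of "pi * t"] by (simp add: power2_eq_square mult_ac)
    finally show "Re (exp w) = Re (1 - cis (2 * pi * t))" .
    have "Im (exp w) = - (2 * sin (pi * t) * cos (pi * t))"
      using s by (simp add: w_def Im_exp sin_diff)
    also have "\<dots> = Im (1 - cis (2 * pi * t))"
      using sin_double[of "pi * t"] by (simp add: mult_ac)
    finally show "Im (exp w) = Im (1 - cis (2 * pi * t))" .
  qed
  moreover have "Ln (exp w) = w"
  proof (rule Ln_exp)
    have "pi * t > 0" "pi * t < pi" using t by auto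
    thus "- pi < Im w" "Im w \<le> pi" unfolding w_def complex.sel using pi_gt_zero by linarith+
  qed
  ultimately have "Ln (1 - cis (2 * pi * t)) = w" by simp
  thus "Im (Ln (1 - cis (2 * pi * t))) = pi * (t - 1/2)"
    by (simp add: w_def algebra_simps)
  have "Re (1 - cis (2 * pi * t)) = 2 * sin (pi * t) * sin (pi * t)"
    using cos_double_sin[of "pi * t"] by (simp add: power2_eq_square mult_ac)
  with s show "Re (1 - cis (2 * pi * t)) > 0" by simp
qed

lemma sin_squared_power_series_has_integral:
  assumes r: "0 \<le> r" "r < 1" and x: "0 \<le> x"
  shows "((\<lambda>t. - pi * Im (Ln (1 - of_real r * cis (2 * pi * t)))) has_integral
          (\<Sum>n. r ^ n * ((sin (pi * real n * x))\<^sup>2 / (real n)\<^sup>2))) {0..x}"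
proof -
  define f where "f = (\<lambda>n t. pi * (r ^ n * (sin (2 * pi * real n * t) / real n)))"
  have "((\<lambda>t. \<Sum>n. f n t) has_integral (\<Sum>n. r ^ n * ((sin (pi * real n * x))\<^sup>2 / (real n)\<^sup>2))) {0..x}"
  proof (rule has_integral_suminf_uniform)
    show "continuous_on {0..x} (f n)" for n
      unfolding f_def by (cases "n = 0") (auto intro!: continuous_intros)
    show "(f n has_integral r ^ n * ((sin (pi * real n * x))\<^sup>2 / (real n)\<^sup>2)) {0..x}" for n
    proof (cases "n = 0")
      case False
      have d: "((\<lambda>t. r ^ n * ((sin (pi * real n * t))\<^sup>2 / (real n)\<^sup>2)) has_vector_derivative f n t) (at t within {0..x})" for t
      proof -
        have "((\<lambda>t. r ^ n * ((sin (pi * real n * t))\<^sup>2 / (real n)\<^sup>2)) has_real_derivative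
            r ^ n * ((2 * sin (pi * real n * t) * (cos (pi * real n * t) * (pi * real n))) / (real n)\<^sup>2)) (at t within {0..x})"
          by (intro DERIV_cmult DERIV_cdivide) (auto intro!: derivative_eq_intros)
        also have "(2 * sin (pi * real n * t) * (cos (pi * real n * t) * (pi * real n))) / (real n)\<^sup>2 =
            pi * ((2 * sin (pi * real n * t) * cos (pi * real n * t)) / real n)"
          using False by (simp add: power2_eq_square)
        also have "2 * sin (pi * real n * t) * cos (pi * real n * t) = sin (2 * pi * real n * t)"
          using sin_double[of "pi * real n * t"] by (simp add: mult.assoc)
        finally show ?thesis
          by (simp add: f_def has_real_derivative_iff_has_vector_derivative mult.left_commute)
      qed
      from fundamental_theorem_of_calculus[OF x d] show ?thesis by simp
    qed (simp add: f_def)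
    show "\<bar>f n t\<bar> \<le> pi * r ^ n" for n t
    proof (cases "n = 0")
      case False
      have "\<bar>sin (2 * pi * real n * t) / real n\<bar> \<le> 1"
        unfolding abs_divide using False
        by (intro divide_le_eq_1_pos[THEN iffD2] order_trans[OF abs_sin_le_one]) auto
      hence "\<bar>f n t\<bar> \<le> pi * (r ^ n * 1)"
        unfolding f_def abs_mult using r by (intro mult_mono) auto
      thus ?thesis by simp
    qed (simp add: f_def)
    show "summable (\<lambda>n. pi * r ^ n)" using r by (intro summable_mult summable_geometric) auto
  qed
  moreover have "(\<Sum>n. f n t) = - pi * Im (Ln (1 - of_real r * cis (2 * pi * t)))" for t
    using sums_mult[OF sin_power_series_sums[OF r, of t], of pi] by (simp add: f_def sums_iff)
  ultimately show ?thesis by simp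
qed

lemma summable_sin_squared_over_squares: "summable (\<lambda>n. (sin (pi * real n * x))\<^sup>2 / (real n)\<^sup>2)"
proof (rule summable_comparison_test')
  show "summable (\<lambda>n. 1 / real n ^ 2)" by (rule inverse_power_summable[of 2, unfolded inverse_eq_divide]) simp
  show "norm ((sin (pi * real n * x))\<^sup>2 / (real n)\<^sup>2) \<le> 1 / real n ^ 2" for n
    by (simp add: divide_right_mono abs_square_le_1)
qed

text \<open>Integrate the sawtooth: as r tends to 1, -pi Im Ln (1 - r exp (2 pi i t)) tends to pi^2
  (1/2 - t), bounded by pi^2 because the principal argument is at most pi in absolute value.
  Integrating before the limit leaves an absolutely convergent series, so the conditionally
  convergent sine series is never summed.\<close>

lemma sin_squared_over_squares_sums:
  assumes x: "0 \<le> x" "x \<le> 1"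
  shows "(\<lambda>n. (sin (pi * real (Suc n) * x))\<^sup>2 / (real (Suc n))\<^sup>2) sums (pi\<^sup>2 / 2 * (x * (1 - x)))"
proof -
  define r where "r = (\<lambda>m. real m / (real m + 1))"
  have r: "0 \<le> r m" "r m < 1" "r m \<le> 1" for m by (auto simp: r_def)
  have r_lim: "r \<longlonglongrightarrow> 1" unfolding r_def by real_asymp
  \<comment> \<open>At t = 0 and t = 1 the number 1 - r exp (2 pi i t) is the positive real 1 - r,
    so the limit there is 0 and not the sawtooth value.\<close>
  define g where "g = (\<lambda>t. if t = 0 \<or> t = 1 then 0 else pi\<^sup>2 * (1/2 - t))"
  define A where "A = (\<Sum>n. (sin (pi * real n * x))\<^sup>2 / (real n)\<^sup>2)"
  have "(g has_integral A) {0..x}"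
  proof (rule has_integral_dominated_convergence)
    show "((\<lambda>t. - pi * Im (Ln (1 - of_real (r m) * cis (2 * pi * t)))) has_integral
          (\<Sum>n. r m ^ n * ((sin (pi * real n * x))\<^sup>2 / (real n)\<^sup>2))) {0..x}" for m
      using r x by (intro sin_squared_power_series_has_integral) auto
    show "(\<lambda>m. \<Sum>n. r m ^ n * ((sin (pi * real n * x))\<^sup>2 / (real n)\<^sup>2)) \<longlonglongrightarrow> A"
      unfolding A_def using summable_sin_squared_over_squares r r_lim by (intro abel_sum_tendsto) auto
    show "(\<lambda>_. pi * pi) integrable_on {0..x}" by auto
    show "\<forall>t\<in>{0..x}. norm (- pi * Im (Ln (1 - of_real (r m) * cis (2 * pi * t)))) \<le> pi * pi" for m
    proof
      fix t
      have "norm (of_real (r m) * cis (2 * pi * t)) < 1"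
        using r by (simp add: norm_mult)
      hence "1 - of_real (r m) * cis (2 * pi * t) \<noteq> 0" by auto
      from mpi_less_Im_Ln[OF this] Im_Ln_le_pi[OF this]
      show "norm (- pi * Im (Ln (1 - of_real (r m) * cis (2 * pi * t)))) \<le> pi * pi"
        by (simp add: abs_mult)
    qed
    show "\<forall>t\<in>{0..x}. (\<lambda>m. - pi * Im (Ln (1 - of_real (r m) * cis (2 * pi * t)))) \<longlonglongrightarrow> g t"
    proof
      fix t assume t: "t \<in> {0..x}"
      show "(\<lambda>m. - pi * Im (Ln (1 - of_real (r m) * cis (2 * pi * t)))) \<longlonglongrightarrow> g t"
      proof (cases "t = 0 \<or> t = 1")
        case True
        hence "cis (2 * pi * t) = 1" by auto
        moreover have "Im (Ln (1 - of_real (r m))) = 0" for m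
          using r(2)[of m] Ln_of_real[of "1 - r m"] by simp
        ultimately show ?thesis using True by (simp add: g_def)
      next
        case False
        with t x have t': "0 < t" "t < 1" by auto
        have "(\<lambda>m. - pi * Im (Ln (1 - of_real (r m) * cis (2 * pi * t)))) \<longlonglongrightarrow> - pi * Im (Ln (1 - of_real 1 * cis (2 * pi * t)))"
          using Im_Ln_one_minus_cis(2)[OF t'] by (intro tendsto_intros r_lim) (auto simp: complex_nonpos_Reals_iff)
        thus ?thesis
          using False by (simp only: Im_Ln_one_minus_cis[OF t'] g_def of_real_1 mult_1) (simp add: power2_eq_square algebra_simps)
      qed
    qed
  qed
  hence "((\<lambda>t. pi\<^sup>2 * (1/2 - t)) has_integral A) {0..x}"
    by (rule has_integral_spike_finite[of "{0,1}", rotated -1]) (auto simp: g_def)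
  moreover have "((\<lambda>t. pi\<^sup>2 * (1/2 - t)) has_integral pi\<^sup>2 / 2 * (x * (1 - x)) - pi\<^sup>2 / 2 * (0 * (1 - 0))) {0..x}"
    using x(1) by (rule fundamental_theorem_of_calculus)
      (auto intro!: derivative_eq_intros simp: field_simps simp flip: has_real_derivative_iff_has_vector_derivative)
  ultimately have "A = pi\<^sup>2 / 2 * (x * (1 - x)) - pi\<^sup>2 / 2 * (0 * (1 - 0))"
    by (rule has_integral_unique)
  hence "A = pi\<^sup>2 / 2 * (x * (1 - x))" by simp
  hence "(\<lambda>n. (sin (pi * real n * x))\<^sup>2 / (real n)\<^sup>2) sums (pi\<^sup>2 / 2 * (x * (1 - x)))"
    using summable_sin_squared_over_squares by (simp add: A_def sums_iff)
  thus ?thesis by (subst sums_Suc_iff) simp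
qed

section \<open>Integrals of the squared sine kernel\<close>

text \<open>With w = 2 pi k this is 2 (1 - cos (w u)) / (w^2 u^3), what two integrations by parts
  make of cos (w u) / u between positive integers.\<close>

definition sin_kernel :: "nat \<Rightarrow> real \<Rightarrow> real" where
  "sin_kernel k u = (sin (pi * real k * u))\<^sup>2 / (pi\<^sup>2 * (real k)\<^sup>2 * u ^ 3)"

lemma sin_kernel_measurable [measurable]: "sin_kernel k \<in> borel_measurable borel"
  unfolding sin_kernel_def by measurable

text \<open>Scaling: \<open>real k * sin_kernel 1 (real k * u) = sin_kernel k u\<close>. The value
  depends on j and k only through their product, so applying this twice exchanges them.\<close>

lemma nn_integral_sin_kernel_rescale:
  assumes "k > 0"
  shows "(\<integral>\<^sup>+u. ennreal (sin_kernel k u) * indicator {real j..} u \<partial>lborel) =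
         (\<integral>\<^sup>+u. ennreal (sin_kernel 1 u) * indicator {real (j * k)..} u \<partial>lborel)"
proof -
  have k: "real k > 0" using assms by simp
  have "(\<integral>\<^sup>+u. ennreal (sin_kernel 1 u) * indicator {real (j * k)..} u \<partial>lborel) =
     ennreal \<bar>real k\<bar> * (\<integral>\<^sup>+u. ennreal (sin_kernel 1 (0 + real k * u)) * indicator {real (j * k)..} (0 + real k * u) \<partial>lborel)"
    using k by (intro nn_integral_real_affine) auto
  also have "\<dots> = (\<integral>\<^sup>+u. ennreal (real k) * (ennreal (sin_kernel 1 (0 + real k * u)) * indicator {real (j * k)..} (0 + real k * u)) \<partial>lborel)"
    by (subst nn_integral_cmult) auto
  also have "\<dots> = (\<integral>\<^sup>+u. ennreal (sin_kernel k u) * indicator {real j..} u \<partial>lborel)"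
  proof (rule nn_integral_cong)
    fix u :: real
    have "real k * sin_kernel 1 (0 + real k * u) = sin_kernel k u"
      using k by (simp add: sin_kernel_def power_mult_distrib power3_eq_cube power2_eq_square mult_ac)
    hence "ennreal (real k) * ennreal (sin_kernel 1 (0 + real k * u)) = ennreal (sin_kernel k u)"
      by (simp flip: ennreal_mult')
    moreover have "indicator {real (j * k)..} (0 + real k * u) = (indicator {real j..} u :: ennreal)"
      using k by (simp add: indicator_def mult.commute[of "real j"])
    ultimately show "ennreal (real k) * (ennreal (sin_kernel 1 (0 + real k * u)) * indicator {real (j * k)..} (0 + real k * u)) =
        ennreal (sin_kernel k u) * indicator {real j..} u"
      by (simp flip: mult.assoc)
  qed
  finally show ?thesis ..
qed

text \<open>Both sides integrate f(u) times the floor of u (0 for u < 1): it is the number of j >= 1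
  with j <= u, and also the index of the cell that contains u.\<close>

lemma suminf_nn_integral_tails:
  assumes [measurable]: "f \<in> borel_measurable borel"
  shows "(\<Sum>j. \<integral>\<^sup>+u. f u * indicator {real (Suc j)..} u \<partial>lborel) =
         (\<Sum>n. of_nat (Suc n) * (\<integral>\<^sup>+u. f u * indicator {real (Suc n)..<real (Suc n) + 1} u \<partial>lborel))"
proof -
  have tails: "(\<Sum>j. indicator {real (Suc j)..} u) = (of_nat (nat \<lfloor>u\<rfloor>) :: ennreal)" for u
  proof -
    have iff: "real (Suc j) \<le> u \<longleftrightarrow> j < nat \<lfloor>u\<rfloor>" for j
      by linarith
    have "(\<Sum>j. indicator {real (Suc j)..} u) = (\<Sum>j<nat \<lfloor>u\<rfloor>. indicator {real (Suc j)..} u :: ennreal)"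
      by (rule suminf_finite) (auto simp: iff simp del: of_nat_Suc)
    also have "\<dots> = (\<Sum>j<nat \<lfloor>u\<rfloor>. 1)"
      by (rule sum.cong) (auto simp: iff simp del: of_nat_Suc)
    finally show ?thesis by simp
  qed
  have cells: "(\<Sum>n. of_nat (Suc n) * indicator {real (Suc n)..<real (Suc n) + 1} u) = (of_nat (nat \<lfloor>u\<rfloor>) :: ennreal)" for u
  proof -
    have iff: "u \<in> {real (Suc n)..<real (Suc n) + 1} \<longleftrightarrow> Suc n = nat \<lfloor>u\<rfloor>" for n
      unfolding atLeastLessThan_iff by linarith
    have "(\<Sum>n. of_nat (Suc n) * indicator {real (Suc n)..<real (Suc n) + 1} u) =
        (\<Sum>n\<in>{nat \<lfloor>u\<rfloor> - 1}. of_nat (Suc n) * (indicator {real (Suc n)..<real (Suc n) + 1} u :: ennreal))"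
      by (rule suminf_finite) (auto simp: indicator_def iff simp del: of_nat_Suc atLeastLessThan_iff)
    also have "\<dots> = of_nat (nat \<lfloor>u\<rfloor>)"
      by (cases "nat \<lfloor>u\<rfloor>") (auto simp: indicator_def iff simp del: of_nat_Suc atLeastLessThan_iff)
    finally show ?thesis .
  qed
  have "(\<Sum>j. \<integral>\<^sup>+u. f u * indicator {real (Suc j)..} u \<partial>lborel) = (\<integral>\<^sup>+u. (\<Sum>j. f u * indicator {real (Suc j)..} u) \<partial>lborel)"
    by (rule nn_integral_suminf[symmetric]) measurable
  also have "\<dots> = (\<integral>\<^sup>+u. (\<Sum>n. of_nat (Suc n) * (f u * indicator {real (Suc n)..<real (Suc n) + 1} u)) \<partial>lborel)"
  proof (rule nn_integral_cong)
    fix u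
    have "(\<Sum>n. of_nat (Suc n) * (f u * indicator {real (Suc n)..<real (Suc n) + 1} u)) =
      (\<Sum>n. f u * (of_nat (Suc n) * indicator {real (Suc n)..<real (Suc n) + 1} u))"
      by (simp only: mult.left_commute)
    thus "(\<Sum>j. f u * indicator {real (Suc j)..} u) = (\<Sum>n. of_nat (Suc n) * (f u * indicator {real (Suc n)..<real (Suc n) + 1} u))"
      by (simp only: ennreal_suminf_cmult tails cells)
  qed
  also have "\<dots> = (\<Sum>n. \<integral>\<^sup>+u. of_nat (Suc n) * (f u * indicator {real (Suc n)..<real (Suc n) + 1} u) \<partial>lborel)"
    by (rule nn_integral_suminf) measurable
  also have "\<dots> = (\<Sum>n. of_nat (Suc n) * (\<integral>\<^sup>+u. f u * indicator {real (Suc n)..<real (Suc n) + 1} u \<partial>lborel))"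
    by (subst nn_integral_cmult) auto
  finally show ?thesis .
qed

lemma nn_integral_atLeast_eq_suminf_cells:
  assumes [measurable]: "f \<in> borel_measurable borel"
  shows "(\<integral>\<^sup>+u. f u * indicator {real k..} u \<partial>lborel) =
         (\<Sum>n. \<integral>\<^sup>+u. f u * indicator {real (k + n)..<real (k + n) + 1} u \<partial>lborel)"
proof -
  have iff: "u \<in> {real (k + n)..<real (k + n) + 1} \<longleftrightarrow> real k \<le> u \<and> n = nat \<lfloor>u\<rfloor> - k" for u n
    unfolding atLeastLessThan_iff by linarith
  have "disjoint_family (\<lambda>n. {real (k + n)..<real (k + n) + 1})"
    unfolding disjoint_family_on_def disjoint_iff iff by blast
  moreover have "(\<Union>n. {real (k + n)..<real (k + n) + 1}) = {real k..}"
    unfolding set_eq_iff UN_iff iff by auto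
  ultimately have "(\<Sum>n. indicator {real (k + n)..<real (k + n) + 1} u) = (indicator {real k..} u :: ennreal)" for u
    by (simp only: suminf_indicator)
  hence "(\<integral>\<^sup>+u. f u * indicator {real k..} u \<partial>lborel) =
      (\<integral>\<^sup>+u. (\<Sum>n. f u * indicator {real (k + n)..<real (k + n) + 1} u) \<partial>lborel)"
    by (simp only: ennreal_suminf_cmult)
  also have "\<dots> = (\<Sum>n. \<integral>\<^sup>+u. f u * indicator {real (k + n)..<real (k + n) + 1} u \<partial>lborel)"
    by (rule nn_integral_suminf) measurable
  finally show ?thesis .
qed

lemma nn_integral_atLeastLessThan_eq_atLeastAtMost:
  fixes a b :: real
  shows "(\<integral>\<^sup>+u. f u * indicator {a..<b} u \<partial>lborel) = (\<integral>\<^sup>+u. f u * indicator {a..b} u \<partial>lborel)"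
proof (rule nn_integral_cong_AE)
  show "AE u in lborel. f u * indicator {a..<b} u = f u * indicator {a..b} u"
    using AE_lborel_singleton[of b] by eventually_elim (simp add: indicator_def less_le)
qed

lemma sin_squared_add_of_nat: "(sin (pi * real k * (real n + x)))\<^sup>2 = (sin (pi * real k * x))\<^sup>2"
proof -
  have "sin (pi * real k * (real n + x)) = sin (real (k * n) * pi + pi * real k * x)"
    by (simp add: algebra_simps)
  also have "\<dots> = cos (real (k * n) * pi) * sin (pi * real k * x)"
    by (simp only: sin_add sin_npi mult_zero_left add_0)
  finally have "(sin (pi * real k * (real n + x)))\<^sup>2 = (cos (real (k * n) * pi))\<^sup>2 * (sin (pi * real k * x))\<^sup>2"
    by (simp only: power_mult_distrib)
  also have "(cos (real (k * n) * pi))\<^sup>2 = 1"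
    by (simp only: cos_squared_eq sin_npi) simp
  finally show ?thesis by simp
qed

text \<open>For positive k and n this is also the k-th cosine coefficient of 1 / (x + n) on [0, 1];
  see \<open>cos_over_shift_has_integral\<close>.\<close>

definition sin_cell :: "nat \<Rightarrow> nat \<Rightarrow> real" where
  "sin_cell k n = integral {0..1} (\<lambda>x. sin_kernel k (real n + x))"

lemma sin_kernel_add_of_nat:
  "sin_kernel k (real n + x) = (sin (pi * real k * x))\<^sup>2 / (pi\<^sup>2 * (real k)\<^sup>2 * (real n + x) ^ 3)"
  by (simp only: sin_kernel_def sin_squared_add_of_nat)

lemma sin_cell_has_integral:
  assumes "k > 0" "n > 0"
  shows "((\<lambda>x. sin_kernel k (real n + x)) has_integral sin_cell k n) {0..1}"
  unfolding sin_cell_def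
  by (intro integrable_integral integrable_continuous_interval)
     (unfold sin_kernel_def, use assms in \<open>auto intro!: continuous_intros\<close>)

lemma sin_kernel_nonneg: "u \<ge> 0 \<Longrightarrow> sin_kernel k u \<ge> 0"
  by (simp add: sin_kernel_def)

lemma sin_cell_nonneg: "k > 0 \<Longrightarrow> n > 0 \<Longrightarrow> sin_cell k n \<ge> 0"
  by (rule has_integral_nonneg[OF sin_cell_has_integral]) (auto intro!: sin_kernel_nonneg)

lemma nn_integral_sin_kernel_cell:
  assumes "k > 0" "n > 0"
  shows "(\<integral>\<^sup>+u. ennreal (sin_kernel k u) * indicator {real n..<real n + 1} u \<partial>lborel) = ennreal (sin_cell k n)"
proof -
  have "(\<integral>\<^sup>+u. ennreal (sin_kernel k u) * indicator {real n..real n + 1} u \<partial>lborel) =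
    ennreal \<bar>1\<bar> * (\<integral>\<^sup>+u. ennreal (sin_kernel k (real n + 1 * u)) * indicator {real n..real n + 1} (real n + 1 * u) \<partial>lborel)"
    by (rule nn_integral_real_affine) auto
  also have "\<dots> = (\<integral>\<^sup>+u. ennreal (sin_kernel k (real n + u)) * indicator {0..1} u \<partial>lborel)"
    by (simp add: indicator_def)
  also have "\<dots> = ennreal (sin_cell k n)"
    using assms by (intro nn_integral_has_integral_lebesgue' sin_cell_has_integral sin_kernel_nonneg) auto
  finally show ?thesis by (simp only: nn_integral_atLeastLessThan_eq_atLeastAtMost)
qed

text \<open>A discrete antiderivative: for n > 0 its increment from n to n + 1 is the integral of
  {u} (1 - {u}) / (2 u^3) over [n, n + 1]. As it tends to gamma / 2, the integral over u >= k
  telescopes.\<close>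

definition harm_remainder :: "nat \<Rightarrow> real" where
  "harm_remainder n = (harm n - ln (real n) - 1 / (2 * real n)) / 2"

lemma suminf_sin_kernel:
  assumes u: "real n \<le> u" "u \<le> real n + 1" and n: "n > 0"
  shows "(\<Sum>j. ennreal (sin_kernel (Suc j) u)) = ennreal ((u - real n) * (real n + 1 - u) / (2 * u ^ 3))"
proof -
  have "u > 0" using u n by (metis of_nat_0_less_iff order_less_le_trans)
  define y where "y = u - real n"
  have y: "real n + y = u" "1 - y = real n + 1 - u" "0 \<le> y" "y \<le> 1" using u by (simp_all add: y_def)
  have "(\<lambda>j. (sin (pi * real (Suc j) * y))\<^sup>2 / (real (Suc j))\<^sup>2) sums (pi\<^sup>2 / 2 * (y * (1 - y)))"
    using y by (intro sin_squared_over_squares_sums) auto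
  from sums_divide[OF this, of "pi\<^sup>2 * u ^ 3"]
  have "(\<lambda>j. (sin (pi * real (Suc j) * y))\<^sup>2 / (real (Suc j))\<^sup>2 / (pi\<^sup>2 * u ^ 3)) sums
      (pi\<^sup>2 / 2 * (y * (1 - y)) / (pi\<^sup>2 * u ^ 3))" .
  also have "pi\<^sup>2 / 2 * (y * (1 - y)) / (pi\<^sup>2 * u ^ 3) = y * (1 - y) / (2 * u ^ 3)"
    by simp
  also have "(\<lambda>j. (sin (pi * real (Suc j) * y))\<^sup>2 / (real (Suc j))\<^sup>2 / (pi\<^sup>2 * u ^ 3)) = (\<lambda>j. sin_kernel (Suc j) u)"
  proof
    fix j
    have "sin_kernel (Suc j) u = (sin (pi * real (Suc j) * y))\<^sup>2 / (pi\<^sup>2 * (real (Suc j))\<^sup>2 * u ^ 3)"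
      using sin_kernel_add_of_nat[of "Suc j" n y] unfolding y(1) .
    thus "(sin (pi * real (Suc j) * y))\<^sup>2 / (real (Suc j))\<^sup>2 / (pi\<^sup>2 * u ^ 3) = sin_kernel (Suc j) u"
      by (simp only: divide_divide_eq_left mult_ac)
  qed
  finally have sums: "(\<lambda>j. sin_kernel (Suc j) u) sums (y * (1 - y) / (2 * u ^ 3))" .
  have "(\<Sum>j. ennreal (sin_kernel (Suc j) u)) = ennreal (y * (1 - y) / (2 * u ^ 3))"
    by (rule suminf_ennreal_eq[OF sin_kernel_nonneg sums]) (use \<open>u > 0\<close> in simp)
  thus ?thesis unfolding y(2) unfolding y_def .
qed

lemma harm_remainder_diff_cell:
  assumes n: "n > 0"
  defines "f \<equiv> \<lambda>u. (u - real n) * (real n + 1 - u) / (2 * u ^ 3)"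
  shows "(f has_integral (harm_remainder (Suc n) - harm_remainder n)) {real n..real n + 1}"
    and "harm_remainder (Suc n) - harm_remainder n \<ge> 0"
proof -
  define N where "N = real n"
  have N: "N > 0" using n by (simp add: N_def)
  \<comment> \<open>Antiderivative read off from (u - N) (N + 1 - u) = -u^2 + (2 N + 1) u - N (N +
    1), divided by 2 u^3.\<close>
  define F where "F = (\<lambda>u. - 1 / 2 * ln u - (2 * N + 1) / 2 * inverse u + N * (N + 1) / 4 * (inverse u)\<^sup>2)"
  have "(f has_integral F (N + 1) - F N) {N..N + 1}"
  proof (rule fundamental_theorem_of_calculus)
    fix u assume u: "u \<in> {N..N + 1}"
    hence u0: "u > 0" using N by auto
    define v where "v = inverse u"
    have ln_deriv: "(ln has_real_derivative v) (at u within {N..N + 1})"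
      using DERIV_ln[OF u0] unfolding v_def by (rule has_field_derivative_at_within)
    have inv_deriv: "(inverse has_real_derivative - (v * v)) (at u within {N..N + 1})"
      using DERIV_inverse[of u "{N..N + 1}"] u0 by (simp add: v_def)
    have "((\<lambda>u. (inverse u)\<^sup>2) has_real_derivative 2 * v * (- (v * v))) (at u within {N..N + 1})"
      using DERIV_power[OF inv_deriv, of 2] by (simp add: v_def mult_ac)
    hence "(F has_real_derivative (- 1 / 2 * v - (2 * N + 1) / 2 * (- (v * v)) + N * (N + 1) / 4 * (2 * v * (- (v * v))))) (at u within {N..N + 1})"
      unfolding F_def by (intro DERIV_add DERIV_diff DERIV_cmult ln_deriv inv_deriv)
    also have "- 1 / 2 * v - (2 * N + 1) / 2 * (- (v * v)) + N * (N + 1) / 4 * (2 * v * (- (v * v))) = f u"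
    proof -
      have "f u = (u - N) * (N + 1 - u) / 2 * (v * v * v)"
        unfolding f_def v_def N_def by (simp add: field_simps power3_eq_cube)
      also have "\<dots> = (- (u * v) * (u * v) * v + (2 * N + 1) * (u * v) * (v * v) - N * (N + 1) * (v * v * v)) / 2"
        by (simp add: algebra_simps)
      also have "u * v = 1" using u0 by (simp add: v_def)
      finally show ?thesis by (simp add: algebra_simps add_divide_distrib diff_divide_distrib)
    qed
    finally show "(F has_vector_derivative f u) (at u within {N..N + 1})"
      by (simp add: has_real_derivative_iff_has_vector_derivative)
  qed simp
  also have "F (N + 1) - F N = harm_remainder (Suc n) - harm_remainder n"
  proof -
    define a b where "a = 1 / N" and "b = 1 / (N + 1)"
    have ab: "N * a = 1" "N * b = 1 - b" "inverse N = a" "inverse (N + 1) = b"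
      using N by (simp_all add: a_def b_def field_simps)
    have F1: "F (N + 1) = - 1 / 2 * ln (N + 1) - (2 * (N * b) + b) / 2 + N * b * (N * b + b) / 4"
      unfolding F_def ab(3,4) by (simp add: power2_eq_square algebra_simps)
    have F2: "F N = - 1 / 2 * ln N - (2 * (N * a) + a) / 2 + N * a * (N * a + a) / 4"
      unfolding F_def ab(3,4) by (simp add: power2_eq_square algebra_simps)
    have H1: "harm_remainder (Suc n) = (harm n + b - ln (N + 1) - b / 2) / 2"
      using harm_Suc[of n, where 'a = real] by (simp add: harm_remainder_def N_def b_def inverse_eq_divide add_ac)
    have H2: "harm_remainder n = (harm n - ln N - a / 2) / 2"
      by (simp add: harm_remainder_def N_def a_def)
    show ?thesis
      unfolding F1 F2 H1 H2 ab(1,2) by (simp add: field_simps)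
  qed
  finally show int: "(f has_integral (harm_remainder (Suc n) - harm_remainder n)) {real n..real n + 1}"
    by (simp only: N_def)
  show "harm_remainder (Suc n) - harm_remainder n \<ge> 0"
    by (rule has_integral_nonneg[OF int]) (auto simp: f_def)
qed

lemma nn_integral_suminf_sin_kernel_cell:
  assumes n: "n > 0"
  shows "(\<integral>\<^sup>+u. (\<Sum>j. ennreal (sin_kernel (Suc j) u)) * indicator {real n..<real n + 1} u \<partial>lborel) =
         ennreal (harm_remainder (Suc n) - harm_remainder n)"
proof -
  have "(\<integral>\<^sup>+u. (\<Sum>j. ennreal (sin_kernel (Suc j) u)) * indicator {real n..real n + 1} u \<partial>lborel) =
    (\<integral>\<^sup>+u. ennreal ((u - real n) * (real n + 1 - u) / (2 * u ^ 3)) * indicator {real n..real n + 1} u \<partial>lborel)"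
    using n by (intro nn_integral_cong) (simp add: indicator_def suminf_sin_kernel)
  also have "\<dots> = ennreal (harm_remainder (Suc n) - harm_remainder n)"
    using harm_remainder_diff_cell(1)[OF n] by (rule nn_integral_has_integral_lebesgue'[rotated]) auto
  finally show ?thesis by (simp only: nn_integral_atLeastLessThan_eq_atLeastAtMost)
qed

lemma harm_remainder_diff_sums:
  "(\<lambda>n. harm_remainder (k + Suc n) - harm_remainder (k + n)) sums (euler_mascheroni / 2 - harm_remainder k)"
proof -
  have "(\<lambda>n. 1 / (2 * real n)) \<longlonglongrightarrow> 0" by real_asymp
  with euler_mascheroni_LIMSEQ have "harm_remainder \<longlonglongrightarrow> (euler_mascheroni - 0) / 2"
    unfolding harm_remainder_def[abs_def] by (intro tendsto_intros) auto
  hence "(\<lambda>n. harm_remainder (k + n)) \<longlonglongrightarrow> euler_mascheroni / 2"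
    using LIMSEQ_ignore_initial_segment[of harm_remainder _ k] by (simp add: add.commute)
  from telescope_sums[OF this] show ?thesis by simp
qed

text \<open>The chain runs in \<open>ennreal\<close>, where nonnegativity justifies each interchange
  without prior convergence; real summability follows at the end since the value is finite. The
  weight of the n-th cell counts the tails u >= j, 1 <= j <= n, that contain it.\<close>

lemma sin_cell_sums:
  assumes k: "k > 0"
  shows "(\<lambda>n. real (Suc n) * sin_cell k (Suc n)) sums (euler_mascheroni / 2 - harm_remainder k)"
proof -
  have "(\<Sum>n. ennreal (real (Suc n) * sin_cell k (Suc n))) =
     (\<Sum>n. of_nat (Suc n) * (\<integral>\<^sup>+u. ennreal (sin_kernel k u) * indicator {real (Suc n)..<real (Suc n) + 1} u \<partial>lborel))"
  proof (rule suminf_cong)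
    fix n
    show "ennreal (real (Suc n) * sin_cell k (Suc n)) =
      of_nat (Suc n) * (\<integral>\<^sup>+u. ennreal (sin_kernel k u) * indicator {real (Suc n)..<real (Suc n) + 1} u \<partial>lborel)"
      by (subst nn_integral_sin_kernel_cell[OF k]) (simp_all only: zero_less_Suc ennreal_mult' of_nat_0_le_iff ennreal_of_nat_eq_real_of_nat)
  qed
  also have "\<dots> = (\<Sum>j. \<integral>\<^sup>+u. ennreal (sin_kernel k u) * indicator {real (Suc j)..} u \<partial>lborel)"
    by (rule suminf_nn_integral_tails[symmetric]) measurable
  also have "\<dots> = (\<Sum>j. \<integral>\<^sup>+u. ennreal (sin_kernel (Suc j) u) * indicator {real k..} u \<partial>lborel)"
  proof (rule suminf_cong)
    fix j
    show "(\<integral>\<^sup>+u. ennreal (sin_kernel k u) * indicator {real (Suc j)..} u \<partial>lborel) =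
        (\<integral>\<^sup>+u. ennreal (sin_kernel (Suc j) u) * indicator {real k..} u \<partial>lborel)"
      using nn_integral_sin_kernel_rescale[OF k, of "Suc j"] nn_integral_sin_kernel_rescale[of "Suc j" k]
      by (simp only: mult.commute[of k] zero_less_Suc)
  qed
  also have "\<dots> = (\<integral>\<^sup>+u. (\<Sum>j. ennreal (sin_kernel (Suc j) u) * indicator {real k..} u) \<partial>lborel)"
    by (rule nn_integral_suminf[symmetric]) measurable
  also have "\<dots> = (\<integral>\<^sup>+u. (\<Sum>j. ennreal (sin_kernel (Suc j) u)) * indicator {real k..} u \<partial>lborel)"
    by (simp only: ennreal_suminf_multc)
  also have "\<dots> = (\<Sum>n. \<integral>\<^sup>+u. (\<Sum>j. ennreal (sin_kernel (Suc j) u)) * indicator {real (k + n)..<real (k + n) + 1} u \<partial>lborel)"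
    by (rule nn_integral_atLeast_eq_suminf_cells) measurable
  also have "\<dots> = (\<Sum>n. ennreal (harm_remainder (Suc (k + n)) - harm_remainder (k + n)))"
    using k by (subst nn_integral_suminf_sin_kernel_cell) auto
  also have "\<dots> = ennreal (euler_mascheroni / 2 - harm_remainder k)"
    using harm_remainder_diff_sums[of k] harm_remainder_diff_cell(2) k
    by (intro suminf_ennreal_eq) auto
  finally have "(\<lambda>n. ennreal (real (Suc n) * sin_cell k (Suc n))) sums ennreal (euler_mascheroni / 2 - harm_remainder k)"
    using summable_sums[OF summableI] by metis
  moreover have "harm_remainder (k + Suc n) - harm_remainder (k + n) \<ge> 0" for n
    using harm_remainder_diff_cell(2)[of "k + n"] k by simp
  hence "euler_mascheroni / 2 - harm_remainder k \<ge> 0"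
    by (rule sums_le[OF _ sums_zero harm_remainder_diff_sums])
  moreover have "real (Suc n) * sin_cell k (Suc n) \<ge> 0" for n
    by (rule mult_nonneg_nonneg[OF of_nat_0_le_iff sin_cell_nonneg[OF k zero_less_Suc]])
  ultimately show ?thesis
    by (simp only: sums_ennreal)
qed

section \<open>Fourier coefficients\<close>

lemma cos_integral_zero:
  fixes k :: nat
  assumes "k > 0"
  shows "((\<lambda>x. cos (2 * pi * real k * x)) has_integral 0) {0..1}"
    and "((\<lambda>x. x * cos (2 * pi * real k * x)) has_integral 0) {0..1}"
proof -
  define w where "w = 2 * pi * real k"
  have w: "w > 0" using assms by (simp add: w_def)
  have periodic: "sin w = 0" "cos w = 1"
    using sin_npi[of "2 * k"] cos_npi[of "2 * k"] by (simp_all add: w_def mult_ac)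
  have "((\<lambda>x. cos (w * x)) has_integral (sin (w * 1) / w - sin (w * 0) / w)) {0..1}"
    by (rule fundamental_theorem_of_calculus)
       (use w in \<open>auto intro!: derivative_eq_intros simp flip: has_real_derivative_iff_has_vector_derivative\<close>)
  thus "((\<lambda>x. cos (2 * pi * real k * x)) has_integral 0) {0..1}"
    using periodic by (simp add: w_def)
  have "((\<lambda>x. x * cos (w * x)) has_integral ((1 * sin (w * 1) / w + cos (w * 1) / w\<^sup>2) - (0 * sin (w * 0) / w + cos (w * 0) / w\<^sup>2))) {0..1}"
    by (rule fundamental_theorem_of_calculus)
       (use w in \<open>auto intro!: derivative_eq_intros simp: power2_eq_square add_divide_distrib simp flip: has_real_derivative_iff_has_vector_derivative\<close>)
  thus "((\<lambda>x. x * cos (2 * pi * real k * x)) has_integral 0) {0..1}"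
    using periodic by (simp add: w_def)
qed

text \<open>Two integrations by parts, with the boundary terms collected in \<open>G\<close>. The
  primitive of sin (w x) / w is normalised to (1 - cos (w x)) / w^2, which vanishes at 0 and 1 as
  sin (w x) does; so no boundary term survives, and what remains is
  \<open>sin_kernel\<close>.\<close>

lemma cos_over_shift_has_integral:
  assumes k: "k > 0" and n: "n > 0"
  shows "((\<lambda>x. inverse (x + real n) * cos (2 * pi * real k * x)) has_integral sin_cell k n) {0..1}"
proof -
  define w where "w = 2 * pi * real k"
  have w: "w > 0" using k by (simp add: w_def)
  have periodic: "sin w = 0" "cos w = 1"
    using sin_npi[of "2 * k"] cos_npi[of "2 * k"] by (simp_all add: w_def mult_ac)
  define G where "G = (\<lambda>x. sin (w * x) / w * inverse (x + real n) + (1 - cos (w * x)) / w\<^sup>2 * (inverse (x + real n))\<^sup>2)"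
  have "((\<lambda>x. inverse (x + real n) * cos (w * x) - sin_kernel k (real n + x)) has_integral G 1 - G 0) {0..1}"
  proof (rule fundamental_theorem_of_calculus)
    fix x :: real assume x: "x \<in> {0..1}"
    define v where "v = inverse (x + real n)"
    have pos: "x + real n > 0" using x n by (simp add: add_nonneg_pos)
    have v_deriv: "((\<lambda>x. inverse (x + real n)) has_real_derivative - (v * v)) (at x within {0..1})"
      using pos by (auto intro!: derivative_eq_intros simp: v_def)
    have v2_deriv: "((\<lambda>x. (inverse (x + real n))\<^sup>2) has_real_derivative 2 * v * (- (v * v))) (at x within {0..1})"
      using DERIV_power[OF v_deriv, of 2] by (simp add: v_def mult_ac)
    have s_deriv: "((\<lambda>x. sin (w * x) / w) has_real_derivative cos (w * x)) (at x within {0..1})"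
      using w by (auto intro!: derivative_eq_intros)
    have c_deriv: "((\<lambda>x. (1 - cos (w * x)) / w\<^sup>2) has_real_derivative sin (w * x) / w) (at x within {0..1})"
      using w by (auto intro!: derivative_eq_intros simp: power2_eq_square)
    have "(G has_real_derivative (cos (w * x) * inverse (x + real n) + - (v * v) * (sin (w * x) / w)
       + (sin (w * x) / w * (inverse (x + real n))\<^sup>2 + 2 * v * (- (v * v)) * ((1 - cos (w * x)) / w\<^sup>2)))) (at x within {0..1})"
      unfolding G_def by (intro DERIV_add DERIV_mult s_deriv c_deriv v_deriv v2_deriv)
    also have "cos (w * x) * inverse (x + real n) + - (v * v) * (sin (w * x) / w)
       + (sin (w * x) / w * (inverse (x + real n))\<^sup>2 + 2 * v * (- (v * v)) * ((1 - cos (w * x)) / w\<^sup>2)) =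
       v * cos (w * x) - 2 * (1 - cos (w * x)) / w\<^sup>2 * v ^ 3"
      by (simp add: v_def[symmetric] power2_eq_square power3_eq_cube)
    also have "2 * (1 - cos (w * x)) / w\<^sup>2 * v ^ 3 = sin_kernel k (real n + x)"
    proof -
      have "cos (w * x) = 1 - 2 * (sin (pi * real k * x))\<^sup>2"
        using cos_double_sin[of "pi * real k * x"] by (simp add: w_def mult_ac)
      hence eq: "2 * (1 - cos (w * x)) / w\<^sup>2 = (sin (pi * real k * x))\<^sup>2 / (pi\<^sup>2 * (real k)\<^sup>2)"
        by (simp add: w_def power_mult_distrib)
      have "v ^ 3 = inverse ((real n + x) ^ 3)"
        by (simp add: v_def power_inverse add.commute)
      thus ?thesis
        unfolding sin_kernel_add_of_nat eq by (simp only: divide_inverse inverse_mult_distrib mult.assoc)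
    qed
    finally show "(G has_vector_derivative inverse (x + real n) * cos (w * x) - sin_kernel k (real n + x)) (at x within {0..1})"
      by (simp add: v_def has_real_derivative_iff_has_vector_derivative)
  qed simp
  moreover have "G 1 - G 0 = 0" by (simp add: G_def periodic)
  ultimately have "((\<lambda>x. inverse (x + real n) * cos (w * x) - sin_kernel k (real n + x)) has_integral 0) {0..1}"
    by simp
  from has_integral_add[OF this sin_cell_has_integral[OF k n]]
  show ?thesis by (simp add: w_def)
qed

text \<open>The first term of the Digamma series, 1 - 1 / x, is split off because it is singular at
  0; times x it is the x - 1 on the right. The remaining terms are continuous on [0, 1].\<close>

lemma x_times_Digamma_sums:
  fixes x :: real
  assumes x: "x > 0"
  shows "(\<lambda>n. x * (inverse (real (Suc (Suc n))) - inverse (x + real (Suc n)))) sums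
           (x * (Digamma x + euler_mascheroni) - (x - 1))"
proof -
  have "(\<lambda>n. inverse (real (Suc n)) - inverse (x + real n)) sums (Digamma x + euler_mascheroni)"
    using summable_sums[OF summable_Digamma[of x]] x by (simp add: Digamma_def)
  hence "(\<lambda>n. x * (inverse (real (Suc n)) - inverse (x + real n))) sums (x * (Digamma x + euler_mascheroni))"
    by (rule sums_mult)
  hence "(\<lambda>n. x * (inverse (real (Suc (Suc n))) - inverse (x + real (Suc n)))) sums
       (x * (Digamma x + euler_mascheroni) - x * (inverse (real (Suc 0)) - inverse (x + real 0)))"
    by (subst sums_Suc_iff)
       (simp only: diff_add_cancel)
  also have "x * (inverse (real (Suc 0)) - inverse (x + real 0)) = x - 1"
    using x by (simp add: right_diff_distrib)
  finally show ?thesis .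
qed

text \<open>With N = n + 1, x / (x + N) = 1 - N / (x + N). The functions 1 and x have vanishing
  cosine integrals, so each term of the series contributes N times the coefficient of 1 / (x + N):
  the origin of the weight in \<open>sin_cell_sums\<close>.\<close>

lemma x_Digamma_cos_has_integral:
  assumes k: "k > 0"
  shows "((\<lambda>x. x * Digamma x * cos (2 * pi * real k * x)) has_integral (euler_mascheroni / 2 - harm_remainder k)) {0..1}"
proof -
  let ?c = "\<lambda>x. cos (2 * pi * real k * x)"
  define f where "f = (\<lambda>n x. x * (inverse (real (Suc (Suc n))) - inverse (x + real (Suc n))) * ?c x)"
  have series: "((\<lambda>x. \<Sum>n. f n x) has_integral (\<Sum>n. real (Suc n) * sin_cell k (Suc n))) {0..1}"
  proof (rule has_integral_suminf_uniform)
    fix n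
    show "continuous_on {0..1} (f n)"
      unfolding f_def by (intro continuous_intros) (auto simp: add_nonneg_eq_0_iff)
    have "((\<lambda>x. inverse (real (Suc (Suc n))) * (x * ?c x) - ?c x
        + real (Suc n) * (inverse (x + real (Suc n)) * ?c x)) has_integral
        inverse (real (Suc (Suc n))) * 0 - 0 + real (Suc n) * sin_cell k (Suc n)) {0..1}"
      by (intro has_integral_add has_integral_diff has_integral_mult_right cos_integral_zero k
          cos_over_shift_has_integral zero_less_Suc)
    hence "((\<lambda>x. inverse (real (Suc (Suc n))) * (x * ?c x) - ?c x
        + real (Suc n) * (inverse (x + real (Suc n)) * ?c x)) has_integral real (Suc n) * sin_cell k (Suc n)) {0..1}"
      by (simp only: mult_zero_right diff_0_right add_0)
    thus "(f n has_integral real (Suc n) * sin_cell k (Suc n)) {0..1}"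
    proof (rule has_integral_eq[rotated])
      fix x :: real assume x: "x \<in> {0..1}"
      define a N v where "a = inverse (real (Suc (Suc n)))" and "N = real (Suc n)" and "v = inverse (x + N)"
      have "x + N > 0" using x by (simp add: N_def)
      hence "(x + N) * v = 1" by (simp add: v_def)
      hence "N * v = 1 - x * v" by (simp add: algebra_simps)
      hence "a * (x * ?c x) - ?c x + N * v * ?c x = a * (x * ?c x) - ?c x + (1 - x * v) * ?c x"
        by (simp only:)
      also have "\<dots> = x * (a - v) * ?c x"
        by (simp add: algebra_simps)
      finally have "a * (x * ?c x) - ?c x + N * v * ?c x = x * (a - v) * ?c x" .
      thus "inverse (real (Suc (Suc n))) * (x * ?c x) - ?c x + real (Suc n) * (inverse (x + real (Suc n)) * ?c x) = f n x"
        unfolding f_def a_def[symmetric] N_def[symmetric] v_def[symmetric] by (simp only: mult.assoc)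
    qed
    fix x :: real assume x: "x \<in> {0..1}"
    have "\<bar>inverse p - inverse q\<bar> = \<bar>p - q\<bar> / (p * q)" if "p > 0" "q > 0" for p q :: real
      using that by (simp add: inverse_diff_inverse abs_mult abs_minus_commute divide_inverse)
    from this[of "real (Suc (Suc n))" "x + real (Suc n)"]
    have "\<bar>inverse (real (Suc (Suc n))) - inverse (x + real (Suc n))\<bar> = (1 - x) / (real (Suc (Suc n)) * (x + real (Suc n)))"
      using x by simp
    also have "\<dots> \<le> 1 / (real (Suc n) * real (Suc n))"
      using x by (intro frac_le mult_mono) auto
    finally have "\<bar>x\<bar> * \<bar>inverse (real (Suc (Suc n))) - inverse (x + real (Suc n))\<bar> * \<bar>?c x\<bar> \<le> 1 * (1 / (real (Suc n) * real (Suc n))) * 1"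
      using x by (intro mult_mono) auto
    thus "\<bar>f n x\<bar> \<le> inverse ((real (Suc n))\<^sup>2)"
      unfolding f_def abs_mult by (simp only: mult_1 mult_1_right power2_eq_square inverse_eq_divide)
  next
    show "summable (\<lambda>n. inverse ((real (Suc n))\<^sup>2))"
      using inverse_power_summable[of 2, where 'a = real] by (subst summable_Suc_iff) simp
  qed
  \<comment> \<open>For x > 0, \<open>x_times_Digamma_sums\<close> solved for x Digamma x gives (1 -
    gamma) x - 1 plus the series.\<close>
  have "((\<lambda>x. (1 - euler_mascheroni) * (x * ?c x) - ?c x + (\<Sum>n. f n x)) has_integral
      (1 - euler_mascheroni) * 0 - 0 + (\<Sum>n. real (Suc n) * sin_cell k (Suc n))) {0..1}"
    by (intro has_integral_add has_integral_diff has_integral_mult_right cos_integral_zero k series)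
  also have "(1 - euler_mascheroni) * 0 - 0 + (\<Sum>n. real (Suc n) * sin_cell k (Suc n)) = euler_mascheroni / 2 - harm_remainder k"
    using sums_unique[OF sin_cell_sums[OF k]] by simp
  finally show ?thesis
  proof (rule has_integral_spike_finite[of "{0}", rotated -1])
    fix x :: real assume x: "x \<in> {0..1} - {0}"
    hence "x > 0" by auto
    from sums_mult2[OF x_times_Digamma_sums[OF this], of "?c x"]
    have "(\<Sum>n. f n x) = (x * (Digamma x + euler_mascheroni) - (x - 1)) * ?c x"
      by (simp only: f_def sums_iff)
    thus "x * Digamma x * ?c x = (1 - euler_mascheroni) * (x * ?c x) - ?c x + (\<Sum>n. f n x)"
      by (simp add: algebra_simps)
  qed auto
qed

lemma continuous_on_mult_ln: "continuous_on {0..} (\<lambda>x::real. x * ln x)"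
proof (rule continuous_on_eq_continuous_within[THEN iffD2], intro ballI)
  fix x :: real assume x: "x \<in> {0..}"
  show "continuous (at x within {0..}) (\<lambda>x. x * ln x)"
  proof (cases "x = 0")
    case True
    have "((\<lambda>x::real. x * ln x) \<longlongrightarrow> 0) (at_right 0)" by real_asymp
    moreover have "at (0::real) within {0..} = at_right 0"
    proof -
      have "{0..} - {0} = {0<..} - {0::real}" by auto
      thus ?thesis by (simp only: at_within_def)
    qed
    ultimately show ?thesis using True by (simp add: continuous_within)
  next
    case False
    thus ?thesis using x by (intro continuous_intros) auto
  qed
qed

text \<open>The differences sin (2 (j + 1) t) - sin (2 j t) telescope. The exhibited factor sin t
  tames the singularity of ln (sin t).\<close>

lemma sin_even_multiple: "sin (2 * real k * t) = 2 * sin t * (\<Sum>j<k. cos ((2 * real j + 1) * t))"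
proof (induction k)
  case (Suc k)
  have "sin (2 * real (Suc k) * t) - sin (2 * real k * t) = 2 * sin t * cos ((2 * real k + 1) * t)"
    using sin_diff_sin[of "2 * real (Suc k) * t" "2 * real k * t"] by (simp add: algebra_simps add_divide_distrib)
  thus ?case using Suc.IH by (simp only: sum.lessThan_Suc distrib_left)
qed simp

text \<open>Integrate the derivative of \<open>H\<close>. As sin (w x) contains the factor sin (pi
  x) and s ln s tends to 0, \<open>H\<close> is continuous at both ends, where it vanishes. The
  cotangent term becomes pi times the trigonometric polynomial 2 cos (pi x) P(x), whose mean is 1
  since only j = 0 yields a constant; hence the value -pi / w.\<close>

lemma ln_sin_cos_has_integral:
  assumes k: "k > 0"
  shows "((\<lambda>x. ln (sin (pi * x)) * cos (2 * pi * real k * x)) has_integral - 1 / (2 * real k)) {0..1}"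
proof -
  define w where "w = 2 * pi * real k"
  have w: "w > 0" using k by (simp add: w_def)
  define P where "P = (\<lambda>x. \<Sum>j<k. cos ((2 * real j + 1) * (pi * x)))"
  have sin_P: "sin (w * x) = 2 * sin (pi * x) * P x" for x
  proof -
    have "w * x = 2 * real k * (pi * x)" by (simp add: w_def)
    thus ?thesis by (simp only: P_def sin_even_multiple)
  qed
  define H where "H = (\<lambda>x. ln (sin (pi * x)) * sin (w * x))"
  have "H = (\<lambda>x. sin (pi * x) * ln (sin (pi * x)) * (2 * P x))"
    by (rule ext) (simp only: H_def sin_P, simp add: mult_ac)
  moreover have "continuous_on {0..1} (\<lambda>x. sin (pi * x) * ln (sin (pi * x)) * (2 * P x))"
    unfolding P_def
    by (intro continuous_intros continuous_on_compose2[OF continuous_on_mult_ln])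
       (auto intro!: sin_ge_zero mult_left_le)
  ultimately have cont: "continuous_on {0..1} H" by simp
  have "((\<lambda>x. pi * (2 * cos (pi * x) * P x) + w * (ln (sin (pi * x)) * cos (w * x))) has_integral H 1 - H 0) {0..1}"
  proof (rule fundamental_theorem_of_calculus_interior[OF _ cont])
    fix x :: real assume x: "x \<in> {0<..<1}"
    have s: "sin (pi * x) > 0" using x by (intro sin_gt_zero) auto
    have "(H has_real_derivative (1 / sin (pi * x) * (cos (pi * x) * pi) * sin (w * x) + ln (sin (pi * x)) * (cos (w * x) * w))) (at x)"
      unfolding H_def using s by (auto intro!: derivative_eq_intros)
    also have "1 / sin (pi * x) * (cos (pi * x) * pi) * sin (w * x) = pi * (2 * cos (pi * x) * P x)"
      using s by (simp add: sin_P)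
    finally show "(H has_vector_derivative pi * (2 * cos (pi * x) * P x) + w * (ln (sin (pi * x)) * cos (w * x))) (at x)"
      by (simp add: has_real_derivative_iff_has_vector_derivative mult_ac)
  qed simp
  hence total: "((\<lambda>x. pi * (2 * cos (pi * x) * P x) + w * (ln (sin (pi * x)) * cos (w * x))) has_integral 0) {0..1}"
    by (simp add: H_def)
  have P_int: "((\<lambda>x. 2 * cos (pi * x) * P x) has_integral 1) {0..1}"
  proof -
    have "((\<lambda>x. cos (2 * pi * real j * x) + cos (2 * pi * real (Suc j) * x)) has_integral (if j = 0 then 1 else 0) + 0) {0..1}" for j
    proof (rule has_integral_add)
      show "((\<lambda>x. cos (2 * pi * real j * x)) has_integral (if j = 0 then 1 else 0)) {0..1}"
      proof (cases "j = 0")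
        case True
        thus ?thesis using has_integral_const_real[of "1::real" 0 1] by simp
      qed (simp add: cos_integral_zero)
    qed (rule cos_integral_zero, simp)
    moreover have "2 * cos (pi * x) * cos ((2 * real j + 1) * (pi * x)) = cos (2 * pi * real j * x) + cos (2 * pi * real (Suc j) * x)" for j x
      using cos_plus_cos[of "2 * pi * real (Suc j) * x" "2 * pi * real j * x"] by (simp add: algebra_simps add_divide_distrib)
    ultimately have "((\<lambda>x. 2 * cos (pi * x) * cos ((2 * real j + 1) * (pi * x))) has_integral (if j = 0 then 1 else 0)) {0..1}" for j
      by simp
    hence "((\<lambda>x. \<Sum>j<k. 2 * cos (pi * x) * cos ((2 * real j + 1) * (pi * x))) has_integral (\<Sum>j<k. if j = 0 then 1 else 0)) {0..1}"
      by (intro has_integral_sum) auto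
    thus ?thesis using k by (simp add: P_def sum_distrib_left)
  qed
  from has_integral_mult_right[OF has_integral_diff[OF total has_integral_mult_right[OF P_int, of pi]], of "1 / w"]
  show ?thesis using w k by (simp add: w_def)
qed

text \<open>At \<open>x = 0\<close> this holds because of the junk values \<open>Gamma 0 = 0\<close> and \<open>ln 0 = 0\<close>.\<close>
lemma ln_Gamma_eq_shift:
  fixes x :: real
  assumes "x \<ge> 0"
  shows "ln (Gamma x) = ln_Gamma (x + 1) - ln x"
proof (cases "x = 0")
  case False
  with assms have x: "x > 0" by simp
  have "x \<notin> \<int>\<^sub>\<le>\<^sub>0" using x by (auto dest: nonpos_Ints_nonpos)
  with x have "ln_Gamma (x + 1) = ln (x * Gamma x)"
    by (subst ln_Gamma_real_pos) (auto simp: Gamma_plus1)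
  thus ?thesis using x Gamma_real_pos[OF x] by (simp add: ln_mult)
qed (simp add: ln_Gamma_real_pos)

lemma continuous_on_x_ln_Gamma: "continuous_on {0..1} (\<lambda>x::real. x * ln (Gamma x))"
proof -
  have "continuous_on {0..1} (\<lambda>x::real. ln_Gamma (x + 1))"
    by (intro continuous_at_imp_continuous_on ballI DERIV_isCont) (auto intro!: derivative_eq_intros)
  hence "continuous_on {0..1} (\<lambda>x::real. x * ln_Gamma (x + 1) - x * ln x)"
    by (intro continuous_intros continuous_on_subset[OF continuous_on_mult_ln]) auto
  thus ?thesis
    by (rule continuous_on_eq) (simp add: ln_Gamma_eq_shift right_diff_distrib)
qed

lemma ln_Gamma_reflection:
  fixes x :: real
  assumes x: "0 < x" "x < 1"
  shows "ln (Gamma x) + ln (Gamma (1 - x)) = ln pi - ln (sin (pi * x))"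
proof -
  have s: "sin (pi * x) > 0" using x by (intro sin_gt_zero) auto
  have "complex_of_real (Gamma x * Gamma (1 - x)) = of_real (pi / sin (pi * x))"
    using Gamma_reflection_complex[of "of_real x"] sin_of_real[of "pi * x", where 'a = complex]
    by (simp flip: Gamma_complex_of_real)
  hence "Gamma x * Gamma (1 - x) = pi / sin (pi * x)"
    by (simp only: of_real_eq_iff)
  hence "ln (Gamma x * Gamma (1 - x)) = ln (pi / sin (pi * x))" by simp
  moreover have "Gamma x > 0" "Gamma (1 - x) > 0"
    using x by (auto intro!: Gamma_real_pos)
  ultimately show ?thesis using s by (simp add: ln_mult ln_div)
qed

lemma ln_Gamma_deriv:
  fixes x :: real
  assumes "x > 0"
  shows "((\<lambda>x. ln (Gamma x)) has_real_derivative Digamma x) (at x)"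
  using has_field_derivative_ln_Gamma_real[OF assms]
proof (rule DERIV_cong_ev[THEN iffD1, rotated -1])
  show "\<forall>\<^sub>F t in nhds x. ln_Gamma t = ln (Gamma t)"
    using eventually_nhds_in_open[of "{0<..}" x] assms
    by (auto elim!: eventually_mono simp: ln_Gamma_real_pos)
qed auto

text \<open>The boundary terms vanish through the factor x at 0 and ln (Gamma 1) = 0 at 1. The three
  summands stay under one integral because integrability of the first, unbounded at 0, is later
  derived from this identity.\<close>

lemma x_ln_Gamma_cos_by_parts:
  assumes k: "k > 0"
  defines "w \<equiv> 2 * pi * real k"
  shows "((\<lambda>x. ln (Gamma x) * cos (w * x) + x * Digamma x * cos (w * x)
            - w * (x * ln (Gamma x) * sin (w * x))) has_integral 0) {0..1}"
proof -
  define F where "F = (\<lambda>x. x * ln (Gamma x) * cos (w * x))"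
  have "((\<lambda>x. ln (Gamma x) * cos (w * x) + x * Digamma x * cos (w * x)
            - w * (x * ln (Gamma x) * sin (w * x))) has_integral F 1 - F 0) {0..1}"
  proof (rule fundamental_theorem_of_calculus_interior)
    show "continuous_on {0..1} F"
      unfolding F_def by (intro continuous_intros continuous_on_x_ln_Gamma)
    fix x :: real assume "x \<in> {0<..<1}"
    hence x: "x > 0" by simp
    have "((\<lambda>x. cos (w * x)) has_real_derivative - sin (w * x) * w) (at x)"
      by (auto intro!: derivative_eq_intros)
    from DERIV_mult[OF DERIV_mult[OF DERIV_ident ln_Gamma_deriv[OF x]] this]
    have "(F has_real_derivative ln (Gamma x) * cos (w * x) + x * Digamma x * cos (w * x)
            - w * (x * ln (Gamma x) * sin (w * x))) (at x)"
      unfolding F_def by (rule DERIV_cong) (simp add: algebra_simps)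
    thus "(F has_vector_derivative ln (Gamma x) * cos (w * x) + x * Digamma x * cos (w * x)
            - w * (x * ln (Gamma x) * sin (w * x))) (at x)"
      by (simp add: has_real_derivative_iff_has_vector_derivative)
  qed simp
  thus ?thesis by (simp add: F_def)
qed

text \<open>cos (w x) is invariant under x -> 1 - x, so by reflection 2 J is the integral of ln pi -
  ln (sin (pi x)) against the cosine. That J exists follows from the integration by parts, whose
  other two integrals are known to exist.\<close>

lemma ln_Gamma_cos_has_integral:
  assumes k: "k > 0"
  shows "((\<lambda>x::real. ln (Gamma x) * cos (2 * pi * real k * x)) has_integral 1 / (4 * real k)) {0..1}"
proof -
  define w where "w = 2 * pi * real k"
  define f where "f = (\<lambda>x::real. ln (Gamma x) * cos (w * x))"
  have "(\<lambda>x::real. w * (x * ln (Gamma x) * sin (w * x))) integrable_on {0..1}"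
    by (intro integrable_continuous_interval continuous_intros continuous_on_x_ln_Gamma)
  then obtain B where B: "((\<lambda>x::real. w * (x * ln (Gamma x) * sin (w * x))) has_integral B) {0..1}"
    by blast
  obtain C where C: "((\<lambda>x::real. x * Digamma x * cos (w * x)) has_integral C) {0..1}"
    using x_Digamma_cos_has_integral[OF k] unfolding w_def by blast
  have J: "(f has_integral 0 + B - C) {0..1}"
    using has_integral_diff[OF has_integral_add[OF x_ln_Gamma_cos_by_parts[OF k, folded w_def] B] C]
    by (simp add: f_def)
  define J where "J = 0 + B - C"
  have fJ: "(f has_integral J) {0..1}" using J by (simp add: J_def)
  have "((\<lambda>x. f (1 - x)) has_integral J) {0..1}"
    using has_integral_affinity[of f J 0 1 "-1" 1] fJ by (simp add: image_affinity_atLeastAtMost_diff)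
  from has_integral_add[OF fJ this]
  have "((\<lambda>x. f x + f (1 - x)) has_integral J + J) {0..1}" .
  hence "((\<lambda>x. ln pi * cos (w * x) - ln (sin (pi * x)) * cos (w * x)) has_integral J + J) {0..1}"
  proof (rule has_integral_spike_finite[of "{0, 1}", rotated -1])
    fix x :: real assume "x \<in> {0..1} - {0, 1}"
    hence x: "0 < x" "x < 1" by auto
    have "w * (1 - x) = - (w * x) + real k * (2 * pi)"
      by (simp add: w_def algebra_simps)
    hence "cos (w * (1 - x)) = cos (w * x)"
      using cos_int_2pin[of "int k"] sin_int_2pin[of "int k"] by (simp add: cos_diff mult_ac)
    hence "f x + f (1 - x) = (ln (Gamma x) + ln (Gamma (1 - x))) * cos (w * x)"
      by (simp add: f_def algebra_simps)
    thus "ln pi * cos (w * x) - ln (sin (pi * x)) * cos (w * x) = f x + f (1 - x)"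
      by (simp only: ln_Gamma_reflection[OF x] left_diff_distrib)
  qed auto
  moreover have "((\<lambda>x. ln pi * cos (w * x) - ln (sin (pi * x)) * cos (w * x)) has_integral ln pi * 0 - (- 1 / (2 * real k))) {0..1}"
    unfolding w_def
    by (intro has_integral_diff has_integral_mult_right cos_integral_zero ln_sin_cos_has_integral k)
  ultimately have "J + J = ln pi * 0 - (- 1 / (2 * real k))"
    by (rule has_integral_unique)
  hence "J = 1 / (4 * real k)" by simp
  with fJ show ?thesis by (simp add: f_def w_def)
qed

text \<open>The coefficient b_k, by \<open>x_ln_Gamma_sin_has_integral\<close>. The value 0 at k = 0
  fits the power series in r, which starts at n = 0.\<close>

definition ln_Gamma_sin_coeff :: "nat \<Rightarrow> real" where
  "ln_Gamma_sin_coeff k = (if k = 0 then 0 else (1 / (4 * real k) + (euler_mascheroni / 2 - harm_remainder k)) / (2 * pi * real k))"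

lemma x_ln_Gamma_sin_has_integral:
  "((\<lambda>x::real. x * ln (Gamma x) * sin (2 * pi * real k * x)) has_integral ln_Gamma_sin_coeff k) {0..1}"
proof (cases "k = 0")
  case False
  hence k: "k > 0" by simp
  define w where "w = 2 * pi * real k"
  have w: "w > 0" using k by (simp add: w_def)
  have "((\<lambda>x::real. w * (x * ln (Gamma x) * sin (w * x))) has_integral
      1 / (4 * real k) + (euler_mascheroni / 2 - harm_remainder k) - 0) {0..1}"
    using has_integral_diff[OF has_integral_add[OF ln_Gamma_cos_has_integral[OF k] x_Digamma_cos_has_integral[OF k]]
        x_ln_Gamma_cos_by_parts[OF k]]
    by (simp add: w_def)
  from has_integral_mult_right[OF this, of "1 / w"]
  show ?thesis using w k by (simp add: ln_Gamma_sin_coeff_def w_def)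
qed (simp add: ln_Gamma_sin_coeff_def)

text \<open>\<open>sin_cell_sums\<close> has nonnegative terms. The sign turns convergence of the
  coefficient series into the absolute convergence that \<open>abel_sum_tendsto\<close> asks
  for.\<close>

lemma ln_Gamma_sin_coeff_nonneg: "ln_Gamma_sin_coeff k \<ge> 0"
proof (cases "k = 0")
  case False
  hence "euler_mascheroni / 2 - harm_remainder k \<ge> 0"
    by (intro sums_le[OF _ sums_zero sin_cell_sums] mult_nonneg_nonneg sin_cell_nonneg) auto
  thus ?thesis by (simp add: ln_Gamma_sin_coeff_def)
qed (simp add: ln_Gamma_sin_coeff_def)

lemma ln_Gamma_sin_coeff_Suc:
  "2 * ln_Gamma_sin_coeff (Suc n) =
     1 / (2 * pi) * ((ln (real n + 1) + euler_mascheroni - harm (Suc n) + 1 / (real n + 1)) / (real n + 1))"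
proof -
  define N h where "N = real n + 1" and "h = (harm (Suc n) :: real)"
  have N: "N > 0" "real (Suc n) = N" by (simp_all add: N_def)
  define Z where "Z = ln N + euler_mascheroni - h + 1 / N"
  have "2 * ln_Gamma_sin_coeff (Suc n) =
      2 * ((1 / (4 * N) + (euler_mascheroni / 2 - (h - ln N - 1 / (2 * N)) / 2)) / (2 * pi * N))"
    unfolding ln_Gamma_sin_coeff_def harm_remainder_def N(2) h_def by simp
  also have "1 / (4 * N) + (euler_mascheroni / 2 - (h - ln N - 1 / (2 * N)) / 2) = Z / 2"
    using N(1) by (simp add: Z_def field_simps)
  also have "2 * (Z / 2 / (2 * pi * N)) = 1 / (2 * pi) * (Z / N)" by simp
  finally show ?thesis by (simp only: Z_def N_def h_def)
qed

section \<open>Abel summation of the cotangent\<close>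

text \<open>The conjugate Poisson kernel: the denominator is |1 - r exp (i t)|^2 = 1 - 2 r cos t +
  r^2, arranged in nonnegative parts. At r = 1 the quotient is sin t / (1 - cos t) = cot (t /
  2).\<close>

definition abel_kernel :: "real \<Rightarrow> real \<Rightarrow> real" where
  "abel_kernel r t = 2 * r * sin t / ((1 - r)\<^sup>2 + 2 * r * (1 - cos t))"

lemma abel_kernel_sums:
  assumes r: "0 \<le> r" "r < 1"
  shows "(\<lambda>n. 2 * r ^ n * sin (real n * t)) sums abel_kernel r t"
proof -
  define z where "z = of_real r * cis t"
  have "norm z < 1" using r by (simp add: z_def norm_mult)
  from sums_mult[OF sums_Im[OF geometric_sums[OF this]], of 2]
  have "(\<lambda>n. 2 * Im (z ^ n)) sums (2 * Im (1 / (1 - z)))" .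
  moreover have "Im (z ^ n) = r ^ n * sin (real n * t)" for n
  proof -
    have "z ^ n = of_real (r ^ n) * cis (real n * t)"
      by (simp only: z_def power_mult_distrib Complex.DeMoivre of_real_power)
    thus ?thesis by simp
  qed
  moreover have "2 * Im (1 / (1 - z)) = abel_kernel r t"
  proof -
    have "r * (r * (cos t * cos t)) + r * (r * (sin t * sin t)) = r * r"
      by (metis distrib_left mult.right_neutral sin_cos_squared_add3)
    hence "(Re (1 - z))\<^sup>2 + (Im (1 - z))\<^sup>2 = (1 - r)\<^sup>2 + 2 * r * (1 - cos t)"
      by (simp add: z_def power2_eq_square algebra_simps)
    thus ?thesis
      by (simp add: Im_divide abel_kernel_def z_def)
  qed
  ultimately show ?thesis by (simp add: mult.assoc)
qed

lemma abel_kernel_double: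
  "abel_kernel r (2 * t) = 4 * r * (sin t * cos t) / ((1 - r)\<^sup>2 + 4 * r * (sin t)\<^sup>2)"
  by (simp add: abel_kernel_def sin_double cos_double_sin mult.assoc)

text \<open>The denominator is at least 4 r sin^2 t and the numerator at most 4 r sin t in absolute
  value. The bound is independent of r, as dominated convergence demands.\<close>

lemma abs_abel_kernel_le:
  assumes r: "0 \<le> r" "r < 1" and s: "sin t > 0"
  shows "\<bar>abel_kernel r (2 * t)\<bar> \<le> 1 / sin t"
proof -
  have pos: "(1 - r)\<^sup>2 + 4 * r * (sin t)\<^sup>2 > 0"
    using r by (intro add_pos_nonneg) auto
  have "\<bar>4 * r * (sin t * cos t)\<bar> * sin t \<le> 4 * r * (sin t * 1) * sin t"
    unfolding abs_mult using r s by (intro mult_mono mult_nonneg_nonneg) auto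
  also have "\<dots> \<le> (1 - r)\<^sup>2 + 4 * r * (sin t)\<^sup>2"
    by (simp add: power2_eq_square)
  finally show ?thesis
    unfolding abel_kernel_double abs_divide using pos s by (simp add: field_simps)
qed

text \<open>By concavity sin lies above its chord on [0, pi / 2], so sin (pi y) >= 2 y for y <= 1/2;
  symmetry covers the other half. The product form is chosen to cancel x and 1 - x in the majorant
  of the final integrand.\<close>

lemma sin_pi_ge:
  assumes x: "0 \<le> x" "x \<le> 1"
  shows "sin (pi * x) \<ge> 2 * x * (1 - x)"
proof -
  have convex: "convex_on {0..pi / 2} (\<lambda>t. - sin t)"
    by (rule f''_ge0_imp_convex[where f' = "\<lambda>t. - cos t" and f'' = sin])
       (auto intro!: derivative_eq_intros sin_ge_zero)
  have half: "sin (pi * y) \<ge> 2 * y" if "0 \<le> y" "y \<le> 1/2" for y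
  proof -
    have "- sin (pi * y) \<le> (- sin (pi / 2) - (- sin 0)) / (pi / 2 - 0) * (pi * y - 0) + (- sin 0)"
      using that by (intro convex_onD_Icc'[OF convex]) (auto simp: mult_left_mono field_simps)
    thus ?thesis by simp
  qed
  show ?thesis
  proof (cases "x \<le> 1/2")
    case True
    have "2 * x * (1 - x) \<le> 2 * x * 1" using x by (intro mult_left_mono) auto
    thus ?thesis using half[of x] True x by simp
  next
    case False
    have "sin (pi * (1 - x)) = sin (pi * x)" by (simp add: right_diff_distrib sin_diff)
    moreover have "2 * x * (1 - x) \<le> 2 * 1 * (1 - x)" using x by (intro mult_right_mono) auto
    ultimately show ?thesis using half[of "1 - x"] False x by simp
  qed
qed

text \<open>Digamma increases from -gamma at 1 to 1 - gamma at 2, and 0 < gamma < 1. This is a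
  Lipschitz constant for \<open>ln_Gamma\<close> on [1, 2].\<close>

lemma abs_Digamma_le_1:
  fixes x :: real
  assumes "1 \<le> x" "x \<le> 2"
  shows "\<bar>Digamma x\<bar> \<le> 1"
proof -
  have "Digamma 1 \<le> Digamma x" "Digamma x \<le> Digamma 2"
    using Digamma_real_mono[of 1 x] Digamma_real_mono[of x 2] assms by auto
  moreover have "Digamma (2::real) = 1 - euler_mascheroni"
    using Digamma_numeral[of "num.Bit0 num.One", where 'a = real] by (simp add: harm_expand)
  moreover have "euler_mascheroni < (1::real)"
    using euler_mascheroni_upper[of 0] ln2_ge_two_thirds by (simp add: harm_expand)
  ultimately show ?thesis
    using euler_mascheroni_pos by (simp add: abs_le_iff)
qed

text \<open>The factor 1 - x records the zero at 1, which has to cancel the pole of the cotangent.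
  The constant is 1 + 2: |ln Gamma(x + 1)| <= 1 - x by the mean value inequality and ln Gamma(2) =
  0, and |ln x| <= 2 (1 - x) / sqrt x.\<close>

lemma abs_ln_Gamma_le:
  fixes x :: real
  assumes x: "0 < x" "x \<le> 1"
  shows "\<bar>ln (Gamma x)\<bar> \<le> 3 * (1 - x) * x powr (-1/2)"
proof -
  have one_le: "1 \<le> x powr (-1/2)"
    using powr_mono2'[of "-1/2" x 1] x by simp
  have "norm (ln_Gamma (x + 1) - ln_Gamma (2::real)) \<le> 1 * norm (x + 1 - 2)"
  proof (rule field_differentiable_bound[of "{1..2}"])
    fix z :: real assume z: "z \<in> {1..2}"
    show "(ln_Gamma has_field_derivative Digamma z) (at z within {1..2})"
      by (rule has_field_derivative_at_within[OF has_field_derivative_ln_Gamma_real]) (use z in auto)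
    show "norm (Digamma z) \<le> 1" using z abs_Digamma_le_1[of z] by simp
  qed (use x in auto)
  moreover have "ln_Gamma (2::real) = 0"
    by (simp add: ln_Gamma_real_pos Gamma_numeral)
  ultimately have 1: "\<bar>ln_Gamma (x + 1)\<bar> \<le> 1 - x" using x by simp
  have 2: "\<bar>ln x\<bar> \<le> 2 * (1 - x) * x powr (-1/2)"
  proof -
    define y where "y = x powr (1/2)"
    have y: "y > 0" "x powr (-1/2) = 1 / y" "y \<le> 1" "y * y = x"
      using x powr_mono2[of "1/2" x 1] by (simp_all add: y_def powr_minus_divide flip: powr_add)
    have "x \<le> y" using y mult_left_le[of y y] by simp
    have "ln (y * y) = ln y + ln y" using y(1) by (intro ln_mult_pos)
    moreover have "ln (1 / y) = - ln y" using y(1) by (simp add: ln_div)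
    moreover have "ln x \<le> 0" using x by simp
    ultimately have "\<bar>ln x\<bar> = 2 * ln (1 / y)" unfolding y(4) by simp
    also have "\<dots> \<le> 2 * (1 / y - 1)"
      using y by (intro mult_left_mono ln_le_minus_one) auto
    also have "1 / y - 1 = (1 - y) * (1 / y)" using y by (simp add: field_simps)
    also have "\<dots> \<le> (1 - x) * (1 / y)" using y \<open>x \<le> y\<close> by (intro mult_right_mono) auto
    finally show ?thesis unfolding y(2) by (simp only: mult.assoc)
  qed
  have "\<bar>ln (Gamma x)\<bar> \<le> \<bar>ln_Gamma (x + 1)\<bar> + \<bar>ln x\<bar>"
    using ln_Gamma_eq_shift[of x] x(1) by (simp only: less_imp_le abs_triangle_ineq4)
  also have "\<dots> \<le> (1 - x) * 1 + 2 * (1 - x) * x powr (-1/2)"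
    using 1 2 unfolding mult_1_right by (rule add_mono)
  also have "\<dots> \<le> (1 - x) * x powr (-1/2) + 2 * (1 - x) * x powr (-1/2)"
    using one_le x by (intro add_right_mono mult_left_mono) auto
  finally show ?thesis by (simp add: algebra_simps)
qed

lemma abel_kernel_ln_Gamma_has_integral:
  assumes r: "0 \<le> r" "r < 1"
  shows "((\<lambda>x. x * ln (Gamma x) * abel_kernel r (2 * pi * x)) has_integral
          (\<Sum>n. r ^ n * (2 * ln_Gamma_sin_coeff n))) {0..1}"
proof -
  have "bounded ((\<lambda>x::real. x * ln (Gamma x)) ` {0..1})"
    by (intro compact_imp_bounded compact_continuous_image continuous_on_x_ln_Gamma) auto
  then obtain B where B: "\<forall>y\<in>(\<lambda>x::real. x * ln (Gamma x)) ` {0..1}. norm y \<le> B" "B > 0"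
    unfolding bounded_pos by blast
  define f where "f = (\<lambda>n x. r ^ n * 2 * (x * ln (Gamma x) * sin (2 * pi * real n * x)))"
  have "((\<lambda>x. \<Sum>n. f n x) has_integral (\<Sum>n. r ^ n * 2 * ln_Gamma_sin_coeff n)) {0..1}"
  proof (rule has_integral_suminf_uniform)
    fix n
    show "continuous_on {0..1} (f n)"
      unfolding f_def by (intro continuous_intros continuous_on_x_ln_Gamma)
    show "(f n has_integral r ^ n * 2 * ln_Gamma_sin_coeff n) {0..1}"
      unfolding f_def by (intro has_integral_mult_right x_ln_Gamma_sin_has_integral)
    fix x :: real assume x: "x \<in> {0..1}"
    have "\<bar>x * ln (Gamma x)\<bar> \<le> B"
      using B(1) x by (simp only: ball_simps real_norm_def)
    hence "\<bar>x * ln (Gamma x) * sin (2 * pi * real n * x)\<bar> \<le> B * 1"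
      unfolding abs_mult[of "x * ln (Gamma x)"] using B(2) by (intro mult_mono) auto
    hence "r ^ n * 2 * \<bar>x * ln (Gamma x) * sin (2 * pi * real n * x)\<bar> \<le> r ^ n * 2 * B"
      using r by (intro mult_left_mono) auto
    thus "\<bar>f n x\<bar> \<le> r ^ n * 2 * B"
      using r by (simp add: f_def abs_mult)
  next
    show "summable (\<lambda>n. r ^ n * 2 * B)"
      using r by (intro summable_mult2 summable_geometric) auto
  qed
  moreover have "(\<Sum>n. f n x) = x * ln (Gamma x) * abel_kernel r (2 * pi * x)" for x
    using sums_unique[OF sums_mult[OF abel_kernel_sums[OF r, of "2 * pi * x"], of "x * ln (Gamma x)"]]
    by (simp add: f_def mult_ac)
  ultimately show ?thesis by (simp add: mult.assoc)
qed

text \<open>Dominated convergence along r = m / (m + 1). The majorant 3/2 x^(-1/2) is x times 3 (1 -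
  x) x^(-1/2), from \<open>abs_ln_Gamma_le\<close>, divided by the lower bound 2 x (1 - x) of sin
  (pi x).\<close>

lemma x_ln_Gamma_cot_has_integral:
  assumes "(\<lambda>n. 2 * ln_Gamma_sin_coeff n) sums I"
  shows "((\<lambda>x::real. x * ln (Gamma x) * cot (pi * x)) has_integral I) {0..1}"
proof -
  define r where "r = (\<lambda>m. real m / (real m + 1))"
  have r: "0 \<le> r m" "r m < 1" "r m \<le> 1" for m by (auto simp: r_def)
  have r_lim: "r \<longlonglongrightarrow> 1" unfolding r_def by real_asymp
  show ?thesis
  proof (rule has_integral_dominated_convergence)
    show "((\<lambda>x. x * ln (Gamma x) * abel_kernel (r m) (2 * pi * x)) has_integral
          (\<Sum>n. r m ^ n * (2 * ln_Gamma_sin_coeff n))) {0..1}" for m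
      using r by (intro abel_kernel_ln_Gamma_has_integral)
    have "(\<lambda>m. \<Sum>n. r m ^ n * (2 * ln_Gamma_sin_coeff n)) \<longlonglongrightarrow> (\<Sum>n. 2 * ln_Gamma_sin_coeff n)"
      using assms r r_lim
      by (intro abel_sum_tendsto) (auto simp: sums_iff ln_Gamma_sin_coeff_nonneg)
    thus "(\<lambda>m. \<Sum>n. r m ^ n * (2 * ln_Gamma_sin_coeff n)) \<longlonglongrightarrow> I"
      using assms by (simp add: sums_iff)
    show "(\<lambda>x::real. 3 / 2 * x powr (-1/2)) integrable_on {0..1}"
      using has_integral_powr_from_0[of "-1/2" 1] by (intro integrable_on_mult_right) auto
    \<comment> \<open>At 0 the factor x and at 1 ln (Gamma 1) = 0 make the integrands vanish,
      whatever values the kernel and the totalised cotangent take there.\<close>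
    have zero: "x * ln (Gamma x) = 0" if "x = 0 \<or> x = 1" for x :: real
      using that by auto
    show "\<forall>x\<in>{0..1}. norm (x * ln (Gamma x) * abel_kernel (r m) (2 * pi * x)) \<le> 3 / 2 * x powr (-1/2)" for m
    proof
      fix x :: real assume x: "x \<in> {0..1}"
      show "norm (x * ln (Gamma x) * abel_kernel (r m) (2 * pi * x)) \<le> 3 / 2 * x powr (-1/2)"
      proof (cases "x = 0 \<or> x = 1")
        case True
        show ?thesis unfolding zero[OF True] by simp
      next
        case False
        with x have x: "0 < x" "x < 1" by auto
        have s: "sin (pi * x) > 0" using x by (intro sin_gt_zero) auto
        have q: "2 * x * (1 - x) > 0" using x by simp
        have "norm (x * ln (Gamma x) * abel_kernel (r m) (2 * pi * x)) =
            x * (\<bar>ln (Gamma x)\<bar> * \<bar>abel_kernel (r m) (2 * (pi * x))\<bar>)"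
          using x by (simp add: abs_mult mult.assoc)
        also have "\<dots> \<le> x * (3 * (1 - x) * x powr (-1/2) * (1 / sin (pi * x)))"
          using abs_ln_Gamma_le[of x] abs_abel_kernel_le[OF r(1,2) s, of m] x s
          by (intro mult_left_mono mult_mono) auto
        also have "\<dots> \<le> x * (3 * (1 - x) * x powr (-1/2) * (1 / (2 * x * (1 - x))))"
          using sin_pi_ge[of x] x q s by (intro mult_left_mono divide_left_mono mult_pos_pos) auto
        also have "\<dots> = 3 / 2 * x powr (-1/2)"
          using x by (simp add: field_simps)
        finally show ?thesis .
      qed
    qed
    show "\<forall>x\<in>{0..1}. (\<lambda>m. x * ln (Gamma x) * abel_kernel (r m) (2 * pi * x)) \<longlonglongrightarrow> x * ln (Gamma x) * cot (pi * x)"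
    proof
      fix x :: real assume x: "x \<in> {0..1}"
      show "(\<lambda>m. x * ln (Gamma x) * abel_kernel (r m) (2 * pi * x)) \<longlonglongrightarrow> x * ln (Gamma x) * cot (pi * x)"
      proof (cases "x = 0 \<or> x = 1")
        case True
        show ?thesis unfolding zero[OF True] by simp
      next
        case False
        with x have x: "0 < x" "x < 1" by auto
        have s: "sin (pi * x) > 0" using x by (intro sin_gt_zero) auto
        have "(\<lambda>m. abel_kernel (r m) (2 * (pi * x))) \<longlonglongrightarrow>
            4 * 1 * (sin (pi * x) * cos (pi * x)) / ((1 - 1)\<^sup>2 + 4 * 1 * (sin (pi * x))\<^sup>2)"
          unfolding abel_kernel_double using s by (intro tendsto_intros r_lim) auto
        also have "4 * 1 * (sin (pi * x) * cos (pi * x)) / ((1 - 1)\<^sup>2 + 4 * 1 * (sin (pi * x))\<^sup>2) = cot (pi * x)"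
          using s by (simp add: cot_def power2_eq_square)
        finally have "(\<lambda>m. abel_kernel (r m) (2 * (pi * x))) \<longlonglongrightarrow> cot (pi * x)" .
        from tendsto_mult_left[OF this, of "x * ln (Gamma x)"] show ?thesis
          by (simp add: mult.assoc)
      qed
    qed
  qed
qed

theorem proposition4p7:
  shows "((\<lambda>x::real. complex_of_real (x * ln (Gamma x) * cot (pi * x))) has_integral
            1 / (2 * of_real pi) * (stieltjes 1 1 + 1 / 2 * (zeta 2 + euler_mascheroni ^ 2)))
          {0..1}"
proof -
  \<comment> \<open>\<open>stieltjes\<close> is complex-valued; as the sum of a series of real
    terms, gamma_1 equals its real part, so the lemmas on real series apply.\<close>
  define S where "S = Re (stieltjes 1 1)"
  have sums: "(\<lambda>n. ln (real n + 1) / (real n + 1) - ((ln (real n + 2))\<^sup>2 - (ln (real n + 1))\<^sup>2) / 2) sums S"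
    using sums_Re[OF stieltjes_one_sums] unfolding S_def Re_complex_of_real .
  hence "(\<lambda>n. complex_of_real (ln (real n + 1) / (real n + 1) - ((ln (real n + 2))\<^sup>2 - (ln (real n + 1))\<^sup>2) / 2)) sums of_real S"
    by (subst sums_of_real_iff)
  with stieltjes_one_sums have S: "stieltjes 1 1 = of_real S"
    by (rule sums_unique2)
  define I where "I = 1 / (2 * pi) * (S + (pi\<^sup>2 / 6 + euler_mascheroni\<^sup>2) / 2)"
  have "(\<lambda>n. 2 * ln_Gamma_sin_coeff (Suc n)) sums I"
    unfolding ln_Gamma_sin_coeff_Suc I_def by (intro sums_mult ln_minus_Digamma_series_sums sums)
  hence "(\<lambda>n. 2 * ln_Gamma_sin_coeff n) sums I"
    by (subst (asm) sums_Suc_iff) (simp add: ln_Gamma_sin_coeff_def)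
  from has_integral_of_real[OF x_ln_Gamma_cot_has_integral[OF this]]
  have "((\<lambda>x::real. complex_of_real (x * ln (Gamma x) * cot (pi * x))) has_integral of_real I) {0..1}" .
  also have "complex_of_real I = 1 / (2 * of_real pi) * (stieltjes 1 1 + 1 / 2 * (zeta 2 + euler_mascheroni ^ 2))"
    unfolding I_def S zeta_2 by simp
  finally show ?thesis .
qed

end
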